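(* Let $G$ be a quartic graph of order $n$ with a path-like structure whose middle blocks are all (isomorphic to) $M_0$ and whose end blocks are each (isomorphic to) one of $D_0,D_1,D_2,D_3,D_4$. Then $\mu(G)=(1+o(1))\frac{4\pi^2}{n^2}$, where $o(1)\to 0$ as $n\to\infty$ uniformly over all such graphs.
   Context: All graphs are finite and simple; quartic means 4-regular. $L(G)=\Delta-A$ is the Laplacian of $G$ and $\mu(G)$, the algebraic connectivity, is the second smallest eigenvalue of $L(G)$. Blocks: $M_0$: vertices $u,a,b,c,d,v$; edges: all six edges among $a,b,c,d$, plus $ua,ub,vc,vd$ (attaching vertices $u,v$ of degree 2). $D_0$: vertices $a,b,c,d,e,w$; edges: all edges among $a,b,c,d,e$ except $de$, plus $wd,we$. $D_1$: vertices $a,b,c,d,e,f,w$; edges: all six edges among $a,b,c,d$, plus $ea,eb,fc,fd,ef,we,wf$. $D_2$: vertices $a,b,c,d,e,f,g,w$; edges: all six edges among $a,b,c,d$, plus $ea,eb,fc,fe,gd,ge,fg,wf,wg$. $D_3$: vertices $a,b,c,d,e,f,g,h,w$; edges: all six edges among $a,b,c,d$, plus $ea,eb,fc,fd,ge,gf,he,hf,gh,wg,wh$. $D_4$: vertices $a,b,c,d,e,f,g,h,i,w$; edges: all edges among $a,b,c,d,e$ except $de$, plus $df,eg$, all six edges among $f,g,h,i$, plus $wh,wi$. In $D_0,\dots,D_4$, $w$ is the unique degree-2 (attaching) vertex. A connected quartic graph has a path-like structure if its blocks can be ordered $B_1,\dots,B_k$ ($k\ge2$) such that consecutive blocks share exactly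 one vertex (a cut vertex) and non-consecutive blocks are vertex-disjoint; $B_1,B_k$ are end blocks (attached at the vertex corresponding to $w$) and $B_2,\dots,B_{k-1}$ are middle blocks (attached at the vertices corresponding to $u,v$). *)

theory Defs
  imports Complex_Main "Jordan_Normal_Form.Char_Poly"
begin

section \<open>Graphs on the vertex set {0..<n}\<close>

(* A finite simple graph of order n: vertex set {0..<n}, edge set E given as a
   symmetric irreflexive set of ordered pairs. *)
definition simple_graph :: "nat \<Rightarrow> (nat \<times> nat) set \<Rightarrow> bool" where
  "simple_graph n E \<longleftrightarrow> E \<subseteq> {0..<n} \<times> {0..<n} \<and> sym E \<and> (\<forall>x. (x, x) \<notin> E)"

definition degree :: "(nat \<times> nat) set \<Rightarrow> nat \<Rightarrow> nat" where
  "degree E x = card {y. (x, y) \<in> E}"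

definition quartic :: "nat \<Rightarrow> (nat \<times> nat) set \<Rightarrow> bool" where
  "quartic n E \<longleftrightarrow> (\<forall>x < n. degree E x = 4)"

definition connected_graph :: "nat \<Rightarrow> (nat \<times> nat) set \<Rightarrow> bool" where
  "connected_graph n E \<longleftrightarrow> (\<forall>x < n. \<forall>y < n. (x, y) \<in> E\<^sup>*)"

section \<open>Laplacian and algebraic connectivity\<close>

(* L(G) = Delta - A *)
definition laplacian :: "nat \<Rightarrow> (nat \<times> nat) set \<Rightarrow> real mat" where
  "laplacian n E = mat n n (\<lambda>(i, j).
      if i = j then real (degree E i) else if (i, j) \<in> E then -1 else 0)"

(* eigenvalues of L(G) with multiplicity, in increasing order; mu is the second one *)
definition laplacian_spectrum :: "nat \<Rightarrow> (nat \<times> nat) set \<Rightarrow> real list" where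
  "laplacian_spectrum n E = sorted_list_of_multiset (proots (char_poly (laplacian n E)))"

definition alg_conn :: "nat \<Rightarrow> (nat \<times> nat) set \<Rightarrow> real" where
  "alg_conn n E = laplacian_spectrum n E ! 1"

section \<open>The blocks\<close>

(* A block is a pair (vertex set, symmetric edge set).
   Vertex labels: a=0, b=1, c=2, d=3, e=4, f=5, g=6, h=7, i=8, u=9, v=10, w=11. *)
type_synonym blk = "nat set \<times> (nat \<times> nat) set"

definition sym_edges :: "(nat \<times> nat) list \<Rightarrow> (nat \<times> nat) set" where
  "sym_edges l = {(x, y). (x, y) \<in> set l \<or> (y, x) \<in> set l}"

abbreviation "vu \<equiv> (9::nat)"
abbreviation "vv \<equiv> (10::nat)"
abbreviation "vw \<equiv> (11::nat)"

(* all six edges among a,b,c,d *)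
definition K4_abcd :: "(nat \<times> nat) list" where
  "K4_abcd = [(0,1),(0,2),(0,3),(1,2),(1,3),(2,3)]"

(* all edges among a,b,c,d,e except de *)
definition K5_minus_de :: "(nat \<times> nat) list" where
  "K5_minus_de = K4_abcd @ [(0,4),(1,4),(2,4)]"

definition M0 :: blk where
  "M0 = ({vu,0,1,2,3,vv}, sym_edges (K4_abcd @ [(vu,0),(vu,1),(vv,2),(vv,3)]))"

definition D0 :: blk where
  "D0 = ({0,1,2,3,4,vw}, sym_edges (K5_minus_de @ [(vw,3),(vw,4)]))"

definition D1 :: blk where
  "D1 = ({0,1,2,3,4,5,vw}, sym_edges (K4_abcd @
          [(4,0),(4,1),(5,2),(5,3),(4,5),(vw,4),(vw,5)]))"

definition D2 :: blk where
  "D2 = ({0,1,2,3,4,5,6,vw}, sym_edges (K4_abcd @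
          [(4,0),(4,1),(5,2),(5,4),(6,3),(6,4),(5,6),(vw,5),(vw,6)]))"

definition D3 :: blk where
  "D3 = ({0,1,2,3,4,5,6,7,vw}, sym_edges (K4_abcd @
          [(4,0),(4,1),(5,2),(5,3),(6,4),(6,5),(7,4),(7,5),(6,7),(vw,6),(vw,7)]))"

definition D4 :: blk where
  "D4 = ({0,1,2,3,4,5,6,7,8,vw}, sym_edges (K5_minus_de @
          [(3,5),(4,6),(5,6),(5,7),(5,8),(6,7),(6,8),(7,8),(vw,7),(vw,8)]))"

definition end_blocks :: "blk set" where
  "end_blocks = {D0, D1, D2, D3, D4}"

section \<open>Path-like structure\<close>

(* image of block B under the embedding f *)
definition img_edges :: "(nat \<Rightarrow> nat) \<Rightarrow> blk \<Rightarrow> (nat \<times> nat) set" where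
  "img_edges f B = (\<lambda>(x, y). (f x, f y)) ` snd B"

(* G (vertex set {0..<n}, edges E) has a path-like structure with blocks
   B_0, ..., B_{k-1} (k \<ge> 2), the i-th block being an isomorphic copy f i of bl i;
   end blocks are copies of D0..D4 attached at (the image of) w, middle blocks are
   copies of M0 attached at u (towards B_{i-1}) and v (towards B_{i+1}). *)
definition path_like_M0_D :: "nat \<Rightarrow> (nat \<times> nat) set \<Rightarrow> bool" where
  "path_like_M0_D n E \<longleftrightarrow>
     (\<exists>(k::nat) (bl::nat \<Rightarrow> blk) (f::nat \<Rightarrow> nat \<Rightarrow> nat). k \<ge> 2 \<and>
        bl 0 \<in> end_blocks \<and> bl (k - 1) \<in> end_blocks \<and>
        (\<forall>i. 0 < i \<and> i < k - 1 \<longrightarrow> bl i = M0) \<and>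
        (\<forall>i < k. inj_on (f i) (fst (bl i))) \<and>
        {0..<n} = (\<Union>i<k. f i ` fst (bl i)) \<and>
        E = (\<Union>i<k. img_edges (f i) (bl i)) \<and>
        (\<forall>i. i + 1 < k \<longrightarrow>
           f i (if i = 0 then vw else vv) = f (i + 1) (if i + 1 = k - 1 then vw else vu) \<and>
           f i ` fst (bl i) \<inter> f (i + 1) ` fst (bl (i + 1)) = {f i (if i = 0 then vw else vv)}) \<and>
        (\<forall>i j. i + 1 < j \<and> j < k \<longrightarrow> f i ` fst (bl i) \<inter> f j ` fst (bl j) = {}))"

end

theory Submission
  imports Defs "HOL-Real_Asymp.Real_Asymp" "Jordan_Normal_Form.Schur_Decomposition"
begin

text \<open>An \<open>M\<^sub>0\<close> block has five vertices per period and effective resistance 5/4 between its cut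
  vertices, so on the scale of the whole graph it behaves like a string of mass density 5 and
  resistance density 5/4, whose first nonzero Neumann frequency for \<open>k\<close> blocks is
  \<open>\<pi>\<^sup>2 / (5 k \<cdot> 5 k / 4) = 4 \<pi>\<^sup>2 / (5 k)\<^sup>2\<close>, with \<open>n = 5 k + O(1)\<close>. For the lower bound, a function
  is compared with its values at the cut vertices, the error being controlled by the local
  energy, and the sharp Poincare inequality of the path with \<open>k + O(1)\<close> vertices is applied. For
  the upper bound, the cosine on the cut vertices is extended harmonically into the blocks.\<close>

section \<open>Orthogonal diagonalization of symmetric matrices\<close>

text \<open>What keeps the constant sharp is a balance of weights. Passing from a function to its
  values at the cut vertices produces a cross term; splitting the square with weight
  \<open>1 / k\<close> inflates the main term by \<open>1 + 1 / k\<close> only, while the error is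
  multiplied by \<open>1 + k\<close>, hence by O(k) against a main term of order k^2. So the local
  error may be estimated crudely, and only \<open>M0\<close> needs an exact effective conductance:
  the five end blocks enter through vertex counts and one common oscillation constant. The resulting
  bounds on \<open>alg_conn\<close> are explicit in \<open>k\<close> alone, and n lies between 5 k
  and 5 k + 10, which is where the uniformity comes from. The upper bound uses the same splitting
  from below, since the interpolated cosine is not constant on a block. As the spectrum is defined
  by the roots of the characteristic polynomial, the variational bounds have to be derived from an
  orthogonal diagonalization whose diagonal lists these roots in sorted order.\<close>

lemma conjugate_real_vec [simp]: "conjugate (v :: real vec) = v"
  by (rule eq_vecI) auto

text \<open>Gram-Schmidt leaves the first vector of a basis starting with \<open>v\<close>
  unchanged, and normalizing the result gives \<open>W\<close>. The scalar \<open>c\<close> is the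
  reciprocal of the norm of \<open>v\<close>; only the direction of the column is used
  later.\<close>

lemma orthogonal_mat_completion:
  fixes v :: "real vec"
  assumes v: "v \<in> carrier_vec n" and v0: "v \<noteq> 0\<^sub>v n"
  shows "\<exists>W c. W \<in> carrier_mat n n \<and> W\<^sup>T * W = 1\<^sub>m n \<and> col W 0 = c \<cdot>\<^sub>v v"
proof -
  interpret cof_vec_space n "TYPE(real)" .
  have n: "n \<noteq> 0"
  proof
    assume "n = 0"
    with v have "v = 0\<^sub>v n" by (intro eq_vecI) auto
    with v0 show False by simp
  qed
  define b where "b = basis_completion v"
  define ws where "ws = gram_schmidt n b"
  from basis_completion[OF v v0, folded b_def]
  have dist_b: "distinct b" and indep: "\<not> lin_dep (set b)" and b: "set b \<subseteq> carrier_vec n"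
    and hdb: "hd b = v" and len_b: "length b = n" by auto
  from hdb len_b n obtain vs where bv: "b = v # vs" by (cases b) auto
  from gram_schmidt_result[OF b dist_b indep refl, folded ws_def]
  have ws: "set ws \<subseteq> carrier_vec n" "corthogonal ws" "length ws = n"
    by (auto simp: len_b)
  from gram_schmidt_hd[OF v, of vs, folded bv] have hdws: "hd ws = v" unfolding ws_def .
  with n ws(3) have ws0: "ws ! 0 = v" by (cases ws) auto
  have dim: "dim_vec (ws ! j) = n" if "j < n" for j
    using ws(1,3) that by (metis carrier_vecD nth_mem subsetD)
  define s where "s j = sqrt (ws ! j \<bullet> ws ! j)" for j
  define W where "W = mat n n (\<lambda>(i, j). ws ! j $ i / s j)"
  have orth: "(ws ! i \<bullet> ws ! j = 0) = (i \<noteq> j)" if "i < n" "j < n" for i j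
    using corthogonalD[OF ws(2), of i j] that ws(3) by simp
  have s2: "s j * s j = ws ! j \<bullet> ws ! j" for j
    unfolding s_def by (simp add: scalar_prod_def sum_nonneg)
  have "W\<^sup>T * W = 1\<^sub>m n"
  proof (rule eq_matI)
    fix i j assume "i < dim_row (1\<^sub>m n)" "j < dim_col (1\<^sub>m n)"
    then have i: "i < n" and j: "j < n" by auto
    have "(W\<^sup>T * W) $$ (i, j) = (\<Sum>k<n. (ws ! i $ k / s i) * (ws ! j $ k / s j))"
      using i j by (simp add: W_def scalar_prod_def atLeast0LessThan)
    also have "\<dots> = (ws ! i \<bullet> ws ! j) / (s i * s j)"
      using dim[OF j] by (simp add: scalar_prod_def atLeast0LessThan sum_divide_distrib)
    also have "\<dots> = 1\<^sub>m n $$ (i, j)"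
      using orth[OF i j] s2[of i] i j by auto
    finally show "(W\<^sup>T * W) $$ (i, j) = 1\<^sub>m n $$ (i, j)" .
  qed (auto simp: W_def)
  moreover have "col W 0 = (1 / s 0) \<cdot>\<^sub>v v"
    using n dim[of 0] by (intro eq_vecI) (auto simp: W_def ws0)
  moreover have "W \<in> carrier_mat n n" by (simp add: W_def)
  ultimately show ?thesis by blast
qed

text \<open>Deflation: rotate an eigenvector for the first entry of \<open>es\<close> into the first
  coordinate. Symmetry then clears the first row along with the first column, and the remaining
  block is symmetric with the other roots. The list \<open>es\<close> may come in any order, which
  is what allows the sorted spectrum on the diagonal.\<close>

lemma symmetric_mat_diagonalization:
  fixes A :: "real mat"
  assumes "A \<in> carrier_mat n n" and "A\<^sup>T = A"
    and "char_poly A = (\<Prod>e\<leftarrow>es. [:- e, 1:])"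
  shows "\<exists>P. P \<in> carrier_mat n n \<and> P\<^sup>T * P = 1\<^sub>m n
    \<and> P\<^sup>T * A * P = mat n n (\<lambda>(i, j). if i = j then es ! i else 0)"
  using assms
proof (induct es arbitrary: n A)
  case Nil
  with degree_monic_char_poly[of A n] have "n = 0" by simp
  then show ?case
    by (intro exI[of _ "1\<^sub>m 0"]) (auto intro!: eq_matI)
next
  case (Cons e es n A)
  let ?n1 = "n - 1"
  note A = Cons(2) and sym = Cons(3)
  from Cons(4) have cp: "char_poly A = [: -e, 1 :] * (\<Prod>e \<leftarrow> es. [:- e, 1:])" by auto
  have mon: "monic (\<Prod>e\<leftarrow> es. [:- e, 1:])" by (rule monic_prod_list, auto)
  have "Polynomial.degree (char_poly A) = Suc (Polynomial.degree (\<Prod>e\<leftarrow> es. [:- e, 1:]))" unfolding cp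
    by (subst degree_mult_eq, insert mon, auto)
  with degree_monic_char_poly[OF A] have n: "n \<noteq> 0" by auto
  have "eigenvalue A e"
    unfolding eigenvalue_root_char_poly[OF A] cp by simp
  then obtain v where v: "v \<in> carrier_vec n" and v0: "v \<noteq> 0\<^sub>v n" and ev: "A *\<^sub>v v = e \<cdot>\<^sub>v v"
    using A unfolding eigenvalue_def eigenvector_def by auto
  from orthogonal_mat_completion[OF v v0] obtain W c where W: "W \<in> carrier_mat n n"
    and WW: "W\<^sup>T * W = 1\<^sub>m n" and c: "col W 0 = c \<cdot>\<^sub>v v" by blast
  have WT: "W\<^sup>T \<in> carrier_mat n n" using W by simp
  have WW': "W * W\<^sup>T = 1\<^sub>m n" by (rule mat_mult_left_right_inverse[OF WT W WW])
  define A' where "A' = W\<^sup>T * A * W"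
  have A': "A' \<in> carrier_mat n n" using A W by (simp add: A'_def)
  have symA': "A'\<^sup>T = A'"
  proof -
    have "A'\<^sup>T = W\<^sup>T * (W\<^sup>T * A)\<^sup>T"
      unfolding A'_def by (rule transpose_mult[of _ n n]) (use A W in auto)
    also have "(W\<^sup>T * A)\<^sup>T = A\<^sup>T * W"
      by (subst transpose_mult[OF WT A]) simp
    finally show ?thesis
      using sym assoc_mult_mat[OF WT A W] by (simp add: A'_def)
  qed
  have col0: "col A' 0 = e \<cdot>\<^sub>v unit_vec n 0"
  proof -
    have "col A' 0 = W\<^sup>T * A *\<^sub>v col W 0"
      unfolding A'_def using n A W by (intro col_mult2) auto
    also have "\<dots> = W\<^sup>T *\<^sub>v (A *\<^sub>v col W 0)"
      by (rule assoc_mult_mat_vec[OF WT A]) (use W in auto)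
    also have "A *\<^sub>v col W 0 = e \<cdot>\<^sub>v col W 0"
      unfolding c using mult_mat_vec[OF A v, of c] ev v by (simp add: smult_smult_assoc mult.commute)
    also have "W\<^sup>T *\<^sub>v (e \<cdot>\<^sub>v col W 0) = e \<cdot>\<^sub>v (W\<^sup>T *\<^sub>v col W 0)"
      by (rule mult_mat_vec[OF WT]) (use W in auto)
    also have "W\<^sup>T *\<^sub>v col W 0 = col (W\<^sup>T * W) 0"
      using n W by (intro col_mult2[symmetric]) auto
    also have "\<dots> = unit_vec n 0" using n by (simp add: WW)
    finally show ?thesis .
  qed
  have A'i0: "A' $$ (i, 0) = (if i = 0 then e else 0)" if "i < n" for i
  proof -
    have "A' $$ (i, 0) = col A' 0 $ i" using that n A' by simp
    then show ?thesis unfolding col0 using that n by simp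
  qed
  have A'0i: "A' $$ (0, i) = (if i = 0 then e else 0)" if "i < n" for i
    using A'i0[OF that] symA' A' n that by (metis carrier_matD index_transpose_mat(1) neq0_conv)
  define A3 where "A3 = mat ?n1 ?n1 (\<lambda>(i, j). A' $$ (Suc i, Suc j))"
  have A3: "A3 \<in> carrier_mat ?n1 ?n1" by (simp add: A3_def)
  let ?blk = "\<lambda>X. four_block_mat (1\<^sub>m 1) (0\<^sub>m 1 ?n1) (0\<^sub>m ?n1 1) X :: real mat"
  define A1 where "A1 = mat 1 1 (\<lambda> _. e)"
  have A1: "A1 \<in> carrier_mat 1 1" by (simp add: A1_def)
  have A'block: "A' = four_block_mat A1 (0\<^sub>m 1 ?n1) (0\<^sub>m ?n1 1) A3"
    using n A' by (intro eq_matI) (auto simp: A1_def A3_def A'i0 A'0i)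
  have symA3: "A3\<^sup>T = A3"
  proof (rule eq_matI)
    fix i j assume "i < dim_row A3" "j < dim_col A3"
    then show "A3\<^sup>T $$ (i, j) = A3 $$ (i, j)"
      using arg_cong[OF symA', of "\<lambda>M. M $$ (Suc i, Suc j)"] A' by (auto simp: A3_def)
  qed (auto simp: A3_def)
  have sim: "similar_mat A' A"
    unfolding similar_mat_def
    by (intro exI, rule similar_mat_witI[of "W\<^sup>T" W n]) (use A W A' WW WW' in \<open>auto simp: A'_def\<close>)
  from cp char_poly_similar[OF sim]
  have "char_poly A' = [: -e,1 :] * (\<Prod> e \<leftarrow> es. [:- e, 1:])" by simp
  also have "char_poly A' = char_poly A1 * char_poly A3"
    unfolding A'block
    by (rule char_poly_four_block_zeros_col[OF A1 _ A3]) simp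
  also have "char_poly A1 = [: -e,1 :]"
    by (simp add: A1_def char_poly_defs det_def sign_def)
  finally have "char_poly A3 = (\<Prod> e \<leftarrow> es. [:- e, 1:])"
    by (metis mult_cancel_left pCons_eq_0_iff zero_neq_one)
  from Cons(1)[OF A3 symA3 this] obtain P where P: "P \<in> carrier_mat ?n1 ?n1"
    and PP: "P\<^sup>T * P = 1\<^sub>m ?n1"
    and PAP: "P\<^sup>T * A3 * P = mat ?n1 ?n1 (\<lambda>(i, j). if i = j then es ! i else 0)" by blast
  define Q where "Q = ?blk P"
  have Q: "Q \<in> carrier_mat n n"
    unfolding Q_def using P n by (intro carrier_matI) auto
  have QT: "Q\<^sup>T \<in> carrier_mat n n" using Q by simp
  have QTb: "Q\<^sup>T = ?blk (P\<^sup>T)"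
    unfolding Q_def using P by (subst transpose_four_block_mat[of _ 1 1 _ ?n1 _ ?n1]) auto
  have QQ: "Q\<^sup>T * Q = 1\<^sub>m n"
    unfolding QTb unfolding Q_def using P n
    by (subst mult_four_block_mat[of _ 1 1 _ ?n1 _ ?n1 _ _ 1 _ ?n1])
       (auto simp: PP intro!: eq_matI)
  have QA: "Q\<^sup>T * A' * Q = mat n n (\<lambda>(i, j). if i = j then (e # es) ! i else 0)"
  proof -
    have "Q\<^sup>T * A' = four_block_mat A1 (0\<^sub>m 1 ?n1) (0\<^sub>m ?n1 1) (P\<^sup>T * A3)"
      unfolding QTb A'block using P A3 A1
      by (subst mult_four_block_mat[of _ 1 1 _ ?n1 _ ?n1 _ _ 1 _ ?n1]) auto
    also have "\<dots> * Q = four_block_mat A1 (0\<^sub>m 1 ?n1) (0\<^sub>m ?n1 1) (P\<^sup>T * A3 * P)"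
      unfolding Q_def using P A3 A1
      by (subst mult_four_block_mat[of _ 1 1 _ ?n1 _ ?n1 _ _ 1 _ ?n1]) auto
    finally show ?thesis
      using n by (auto simp: PAP A1_def nth_Cons' intro!: eq_matI)
  qed
  have "(W * Q)\<^sup>T * (W * Q) = 1\<^sub>m n"
  proof -
    have "(W * Q)\<^sup>T * (W * Q) = Q\<^sup>T * (W\<^sup>T * W) * Q"
      using W Q WT QT by (simp add: transpose_mult[OF W Q] assoc_mult_mat[of _ n n _ n _ n])
    then show ?thesis using QQ QT by (simp add: WW)
  qed
  moreover have "(W * Q)\<^sup>T * A * (W * Q) = Q\<^sup>T * A' * Q"
    unfolding A'_def using A W Q WT QT by (simp add: transpose_mult[OF W Q] assoc_mult_mat[of _ n n _ n _ n])
  moreover have "W * Q \<in> carrier_mat n n" using W Q by simp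
  ultimately show ?case using QA by metis
qed

text \<open>The Hermitian form \<open>S\<close> of an eigenvector is its own conjugate by symmetry
  of \<open>A\<close>, and it equals \<open>a\<close> times the positive squared norm
  \<open>N\<close>.\<close>

lemma symmetric_real_mat_eigenvalue_real:
  fixes A :: "real mat"
  assumes A: "A \<in> carrier_mat n n" and sym: "A\<^sup>T = A"
    and ev: "eigenvalue (map_mat complex_of_real A) a"
  shows "a \<in> \<real>"
proof -
  let ?B = "map_mat complex_of_real A"
  have B: "?B \<in> carrier_mat n n" using A by simp
  from ev obtain v where v: "v \<in> carrier_vec n" and v0: "v \<noteq> 0\<^sub>v n" and e: "?B *\<^sub>v v = a \<cdot>\<^sub>v v"
    using B unfolding eigenvalue_def eigenvector_def by auto
  have symA: "A $$ (i, j) = A $$ (j, i)" if "i < n" "j < n" for i j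
    using that A by (metis sym carrier_matD index_transpose_mat(1))
  define S where "S = (\<Sum>i<n. \<Sum>j<n. complex_of_real (A $$ (i, j)) * v $ j * cnj (v $ i))"
  define N where "N = (\<Sum>i<n. (cmod (v $ i))\<^sup>2)"
  have "cnj S = (\<Sum>i<n. \<Sum>j<n. complex_of_real (A $$ (i, j)) * cnj (v $ j) * v $ i)"
    by (simp add: S_def cnj_sum)
  also have "\<dots> = (\<Sum>j<n. \<Sum>i<n. complex_of_real (A $$ (i, j)) * cnj (v $ j) * v $ i)"
    by (rule sum.swap)
  also have "\<dots> = S"
    unfolding S_def by (intro sum.cong refl) (auto simp: symA)
  finally have S: "cnj S = S" .
  have "S = (\<Sum>i<n. (?B *\<^sub>v v) $ i * cnj (v $ i))"
    unfolding S_def using A v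
    by (intro sum.cong refl) (auto simp: scalar_prod_def atLeast0LessThan sum_distrib_right)
  also have "\<dots> = a * of_real N"
    unfolding e N_def using v
    by (simp add: sum_distrib_left mult.assoc flip: complex_norm_square)
  finally have aN: "S = a * of_real N" .
  from v v0 obtain i where i: "i < n" "v $ i \<noteq> 0" by (metis carrier_vecD eq_vecI index_zero_vec)
  have "N > 0" unfolding N_def using i by (intro sum_pos2[of _ i]) auto
  then have "cnj a = a" using S aN by simp
  then show ?thesis by (simp add: Reals_cnj_iff)
qed

text \<open>The factorization exists over the complex numbers; its roots are real eigenvalues, so it
  pulls back along the injective embedding of the reals.\<close>

lemma symmetric_real_mat_char_poly_splits:
  fixes A :: "real mat"
  assumes A: "A \<in> carrier_mat n n" and sym: "A\<^sup>T = A"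
  shows "\<exists>es. char_poly A = (\<Prod>e\<leftarrow>es. [:- e, 1:])"
proof -
  let ?B = "map_mat complex_of_real A"
  have B: "?B \<in> carrier_mat n n" using A by simp
  interpret h: map_poly_inj_comm_ring_hom complex_of_real ..
  from char_poly_factorized[OF B] obtain as where as: "char_poly ?B = (\<Prod>a\<leftarrow>as. [:- a, 1:])" by blast
  have "complex_of_real (Re a) = a" if "a \<in> set as" for a
  proof -
    have "poly (char_poly ?B) a = 0" unfolding as by (rule linear_poly_root[OF that])
    then have "eigenvalue ?B a" unfolding eigenvalue_root_char_poly[OF B] .
    from symmetric_real_mat_eigenvalue_real[OF A sym this] show ?thesis by simp
  qed
  then have as': "as = map complex_of_real (map Re as)" by (simp add: map_idI)
  have "map_poly complex_of_real (char_poly A) = char_poly ?B"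
    by (rule of_real_hom.char_poly_hom[symmetric, OF A])
  also have "\<dots> = map_poly complex_of_real (\<Prod>e\<leftarrow>map Re as. [:- e, 1:])"
    unfolding as by (subst as') (simp add: h.hom_prod_list o_def hom_distribs)
  finally show ?thesis by (metis h.injectivity)
qed

text \<open>Links the list that defines \<open>laplacian_spectrum\<close> to a diagonalization:
  sorting only permutes the linear factors of the characteristic polynomial.\<close>

lemma symmetric_mat_spectral:
  fixes A :: "real mat"
  assumes A: "A \<in> carrier_mat n n" and sym: "A\<^sup>T = A"
  defines "es \<equiv> sorted_list_of_multiset (proots (char_poly A))"
  shows "sorted es" "length es = n"
    "\<exists>P. P \<in> carrier_mat n n \<and> P\<^sup>T * P = 1\<^sub>m n
      \<and> P\<^sup>T * A * P = mat n n (\<lambda>(i, j). if i = j then es ! i else 0)"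
proof -
  from symmetric_real_mat_char_poly_splits[OF A sym] obtain rs where
    rs: "char_poly A = (\<Prod>e\<leftarrow>rs. [:- e, 1:])" by blast
  have "proots (\<Prod>e\<leftarrow>xs. [:- e, 1:]) = mset xs" for xs :: "real list"
  proof (induct xs)
    case (Cons a xs)
    have "(\<Prod>e\<leftarrow>xs. [:- e, 1:]) \<noteq> 0"
      by (induct xs) (simp_all del: mult_pCons_left)
    with Cons show ?case by (simp add: proots_mult del: mult_pCons_left)
  qed simp
  then have mset: "mset es = mset rs" by (simp add: es_def rs)
  then have "char_poly A = (\<Prod>e\<leftarrow>es. [:- e, 1:])"
    unfolding rs by (simp flip: prod_mset_prod_list)
  then show "\<exists>P. P \<in> carrier_mat n n \<and> P\<^sup>T * P = 1\<^sub>m n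
      \<and> P\<^sup>T * A * P = mat n n (\<lambda>(i, j). if i = j then es ! i else 0)"
    by (rule symmetric_mat_diagonalization[OF A sym])
  show "sorted es" by (simp add: es_def)
  have "Polynomial.degree (\<Prod>e\<leftarrow>rs. [:- e, 1:]) = length rs"
    by (rule degree_linear_factors)
  then show "length es = n"
    using degree_monic_char_poly[OF A] mset_eq_length[OF mset] by (simp add: rs)
qed

section \<open>Variational bounds for the second eigenvalue\<close>

context
  fixes A P :: "real mat" and es :: "real list" and n :: nat
  assumes A: "A \<in> carrier_mat n n" and P: "P \<in> carrier_mat n n" and PP: "P\<^sup>T * P = 1\<^sub>m n"
    and D: "P\<^sup>T * A * P = mat n n (\<lambda>(i, j). if i = j then es ! i else 0)"
begin

lemma orthogonal_coords_inverse:
  assumes x: "x \<in> carrier_vec n"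
  shows "P *\<^sub>v (P\<^sup>T *\<^sub>v x) = x" "P\<^sup>T *\<^sub>v (P *\<^sub>v x) = x"
proof -
  have PT: "P\<^sup>T \<in> carrier_mat n n" using P by simp
  have PP': "P * P\<^sup>T = 1\<^sub>m n" by (rule mat_mult_left_right_inverse[OF PT P PP])
  show "P *\<^sub>v (P\<^sup>T *\<^sub>v x) = x"
    using assoc_mult_mat_vec[OF P PT x] x by (simp add: PP')
  show "P\<^sup>T *\<^sub>v (P *\<^sub>v x) = x"
    using assoc_mult_mat_vec[OF PT P x] x by (simp add: PP)
qed

lemma orthogonal_coords_scalar_prod:
  assumes x: "x \<in> carrier_vec n" and z: "z \<in> carrier_vec n"
  shows "(P\<^sup>T *\<^sub>v x) \<bullet> (P\<^sup>T *\<^sub>v z) = x \<bullet> z"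
proof -
  have "(P\<^sup>T *\<^sub>v x) \<bullet> (P\<^sup>T *\<^sub>v z) = x \<bullet> (P *\<^sub>v (P\<^sup>T *\<^sub>v z))"
    by (rule transpose_vec_mult_scalar[OF P]) (use P x z in auto)
  then show ?thesis using orthogonal_coords_inverse[OF z] by simp
qed

lemma orthogonal_coords_quadratic_form:
  assumes x: "x \<in> carrier_vec n"
  shows "x \<bullet> (A *\<^sub>v x) = (\<Sum>i<n. es ! i * ((P\<^sup>T *\<^sub>v x) $ i)\<^sup>2)"
proof -
  have PT: "P\<^sup>T \<in> carrier_mat n n" using P by simp
  define y where "y = P\<^sup>T *\<^sub>v x"
  have y: "y \<in> carrier_vec n" and xy: "x = P *\<^sub>v y"
    using x P orthogonal_coords_inverse[OF x] by (auto simp: y_def)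
  have "x \<bullet> (A *\<^sub>v x) = y \<bullet> (P\<^sup>T *\<^sub>v (A *\<^sub>v x))"
    unfolding y_def by (rule orthogonal_coords_scalar_prod[symmetric]) (use A x in auto)
  also have "P\<^sup>T *\<^sub>v (A *\<^sub>v x) = P\<^sup>T * A * P *\<^sub>v y"
    using assoc_mult_mat_vec[of "P\<^sup>T * A" n n P n y] assoc_mult_mat_vec[OF PT A x] A P y PT xy by simp
  also have "y \<bullet> \<dots> = (\<Sum>i<n. es ! i * (y $ i)\<^sup>2)"
  proof -
    have "(mat n n (\<lambda>(i, j). if i = j then es ! i else 0) *\<^sub>v y) $ i = es ! i * y $ i" if "i < n" for i
      using that y by (simp add: scalar_prod_def if_distrib[of "\<lambda>t. t * _"] cong: if_cong)
    then show ?thesis unfolding D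
      using y by (auto simp: scalar_prod_def[of y] atLeast0LessThan power2_eq_square intro!: sum.cong)
  qed
  finally show ?thesis unfolding y_def .
qed

end

lemma scalar_prod_self_pos:
  fixes x :: "real vec"
  assumes "x \<in> carrier_vec n" "x \<noteq> 0\<^sub>v n"
  shows "x \<bullet> x > 0"
  using conjugate_square_greater_0_vec[OF assms(1)] assms by simp

lemma scalar_prod_self_eq: "x \<in> carrier_vec n \<Longrightarrow> x \<bullet> x = (\<Sum>i<n. (x $ i :: real)\<^sup>2)"
  by (auto simp: scalar_prod_def atLeast0LessThan power2_eq_square)

text \<open>A Rayleigh bound on one hyperplane bounds the second eigenvalue, since that hyperplane meets
  the span of the first two eigenvectors.\<close>

lemma second_eigenvalue_ge:
  fixes A :: "real mat"
  assumes A: "A \<in> carrier_mat n n" and sym: "A\<^sup>T = A" and n: "2 \<le> n" and u: "u \<in> carrier_vec n"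
    and bound: "\<And>x. x \<in> carrier_vec n \<Longrightarrow> x \<bullet> u = 0 \<Longrightarrow> c * (x \<bullet> x) \<le> x \<bullet> (A *\<^sub>v x)"
  shows "c \<le> sorted_list_of_multiset (proots (char_poly A)) ! 1"
proof -
  define es where "es = sorted_list_of_multiset (proots (char_poly A))"
  note spec = symmetric_mat_spectral[OF A sym, folded es_def]
  from spec(3) obtain P where P: "P \<in> carrier_mat n n" and PP: "P\<^sup>T * P = 1\<^sub>m n"
    and D: "P\<^sup>T * A * P = mat n n (\<lambda>(i, j). if i = j then es ! i else 0)" by blast
  note inv = orthogonal_coords_inverse[OF A P PP D]
  note sp = orthogonal_coords_scalar_prod[OF A P PP D]
  note qf = orthogonal_coords_quadratic_form[OF A P PP D]
  define w where "w = P\<^sup>T *\<^sub>v u"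
  obtain \<alpha> \<beta> where ab: "\<alpha> * w $ 0 + \<beta> * w $ 1 = 0" "\<alpha> \<noteq> 0 \<or> \<beta> \<noteq> 0"
  proof (cases "w $ 0 = 0 \<and> w $ 1 = 0")
    case True
    then show ?thesis using that[of 1 0] by simp
  next
    case False
    then show ?thesis using that[of "w $ 1" "- w $ 0"] by auto
  qed
  define y where "y = vec n (\<lambda>i. if i = 0 then \<alpha> else if i = 1 then \<beta> else 0)"
  have y: "y \<in> carrier_vec n" by (simp add: y_def)
  define x where "x = P *\<^sub>v y"
  have x: "x \<in> carrier_vec n" using P y by (simp add: x_def)
  have Px: "P\<^sup>T *\<^sub>v x = y" unfolding x_def by (rule inv[OF y])
  have split: "(\<Sum>i<n. g i) = g 0 + g 1 + (\<Sum>i=2..<n. g i)" for g :: "nat \<Rightarrow> real"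
  proof -
    have "{..<n} = {0, 1} \<union> {2..<n}" using n by auto
    then show ?thesis by (simp add: sum.union_disjoint)
  qed
  have "x \<bullet> u = y \<bullet> w" using sp[OF x u] unfolding Px w_def by simp
  also have "\<dots> = (\<Sum>i<n. y $ i * w $ i)"
    using P u by (auto simp: w_def scalar_prod_def atLeast0LessThan)
  also have "\<dots> = 0" unfolding split using n ab by (simp add: y_def)
  finally have xu: "x \<bullet> u = 0" .
  have xx: "x \<bullet> x = \<alpha>\<^sup>2 + \<beta>\<^sup>2"
    using sp[OF x x] unfolding Px scalar_prod_self_eq[OF y] split using n by (simp add: y_def)
  have "x \<bullet> (A *\<^sub>v x) = es ! 0 * \<alpha>\<^sup>2 + es ! 1 * \<beta>\<^sup>2"
    unfolding qf[OF x] Px split using n by (simp add: y_def)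
  also have "\<dots> \<le> es ! 1 * \<alpha>\<^sup>2 + es ! 1 * \<beta>\<^sup>2"
    using spec(1,2) n by (intro add_mono mult_right_mono sorted_nth_mono) auto
  finally have "c * (\<alpha>\<^sup>2 + \<beta>\<^sup>2) \<le> es ! 1 * (\<alpha>\<^sup>2 + \<beta>\<^sup>2)"
    using bound[OF x xu] by (simp add: xx algebra_simps)
  moreover have "\<alpha>\<^sup>2 + \<beta>\<^sup>2 > 0" using ab(2) by (simp add: sum_power2_gt_zero_iff)
  ultimately show ?thesis unfolding es_def by simp
qed

text \<open>The plane spanned by \<open>u\<close> and \<open>x\<close> contains a nonzero
  \<open>z\<close> orthogonal to the first eigenvector, so its quadratic form is at least
  \<open>es ! 1\<close> times its squared norm. Since \<open>u\<close> is in the kernel, the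
  component along \<open>u\<close> leaves the form unchanged, and as \<open>c\<close> is nonnegative
  it can only enlarge the right-hand side.\<close>

lemma second_eigenvalue_le:
  fixes A :: "real mat"
  assumes A: "A \<in> carrier_mat n n" and sym: "A\<^sup>T = A" and n: "2 \<le> n"
    and u: "u \<in> carrier_vec n" "u \<noteq> 0\<^sub>v n" and Au: "A *\<^sub>v u = 0\<^sub>v n"
    and x: "x \<in> carrier_vec n" "x \<noteq> 0\<^sub>v n" and xu: "x \<bullet> u = 0"
    and c: "0 \<le> c" and bound: "x \<bullet> (A *\<^sub>v x) \<le> c * (x \<bullet> x)"
  shows "sorted_list_of_multiset (proots (char_poly A)) ! 1 \<le> c"
proof -
  define es where "es = sorted_list_of_multiset (proots (char_poly A))"
  note spec = symmetric_mat_spectral[OF A sym, folded es_def]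
  from spec(3) obtain P where P: "P \<in> carrier_mat n n" and PP: "P\<^sup>T * P = 1\<^sub>m n"
    and D: "P\<^sup>T * A * P = mat n n (\<lambda>(i, j). if i = j then es ! i else 0)" by blast
  note sp = orthogonal_coords_scalar_prod[OF A P PP D]
  note qf = orthogonal_coords_quadratic_form[OF A P PP D]
  have PT: "P\<^sup>T \<in> carrier_mat n n" using P by simp
  define a b where "a = (P\<^sup>T *\<^sub>v u) $ 0" and "b = (P\<^sup>T *\<^sub>v x) $ 0"
  obtain \<alpha> \<beta> where ab: "\<alpha> * a + \<beta> * b = 0" "\<alpha> \<noteq> 0 \<or> \<beta> \<noteq> 0"
  proof (cases "a = 0 \<and> b = 0")
    case True
    then show ?thesis using that[of 1 0] by simp
  next
    case False
    then show ?thesis using that[of b "- a"] by auto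
  qed
  define z where "z = \<alpha> \<cdot>\<^sub>v u + \<beta> \<cdot>\<^sub>v x"
  have z: "z \<in> carrier_vec n" using u x by (simp add: z_def)
  have Ax: "A *\<^sub>v x \<in> carrier_vec n" using A x by simp
  have ux: "u \<bullet> x = 0" using xu comm_scalar_prod[OF u(1) x(1)] by simp
  have zz: "z \<bullet> z = \<alpha>\<^sup>2 * (u \<bullet> u) + \<beta>\<^sup>2 * (x \<bullet> x)"
    unfolding z_def using u(1) x(1) xu ux
    by (simp add: add_scalar_prod_distrib[of _ n] scalar_prod_add_distrib[of _ n] power2_eq_square)
  have "\<alpha> \<cdot>\<^sub>v 0\<^sub>v n = 0\<^sub>v n" by auto
  then have Az: "A *\<^sub>v z = \<beta> \<cdot>\<^sub>v (A *\<^sub>v x)"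
    unfolding z_def using A u(1) x(1) Ax
    by (simp add: mult_add_distrib_mat_vec[OF A] mult_mat_vec[OF A] Au)
  have "u \<bullet> (A *\<^sub>v x) = (A *\<^sub>v u) \<bullet> x"
    using transpose_vec_mult_scalar[OF A x(1) u(1)] by (simp add: sym)
  then have uAx: "u \<bullet> (A *\<^sub>v x) = 0" using x(1) by (simp add: Au)
  have zAz: "z \<bullet> (A *\<^sub>v z) = \<beta>\<^sup>2 * (x \<bullet> (A *\<^sub>v x))"
    unfolding Az unfolding z_def using u(1) x(1) Ax uAx
    by (simp add: add_scalar_prod_distrib[of _ n] power2_eq_square)
  have zpos: "z \<bullet> z > 0"
    unfolding zz using scalar_prod_self_pos[OF u] scalar_prod_self_pos[OF x] ab(2)
    by (auto intro: add_pos_nonneg add_nonneg_pos)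
  have Pz: "P\<^sup>T *\<^sub>v z \<in> carrier_vec n" using PT z by simp
  have "(P\<^sup>T *\<^sub>v z) $ 0 = \<alpha> * a + \<beta> * b"
    unfolding z_def a_def b_def using P u(1) x(1) n
    by (simp add: mult_add_distrib_mat_vec[OF PT] mult_mat_vec[OF PT])
  then have z0: "(P\<^sup>T *\<^sub>v z) $ 0 = 0" using ab(1) by simp
  have "es ! 1 * (z \<bullet> z) = (\<Sum>i<n. es ! 1 * ((P\<^sup>T *\<^sub>v z) $ i)\<^sup>2)"
    using sp[OF z z] scalar_prod_self_eq[OF Pz] by (simp flip: sum_distrib_left)
  also have "\<dots> \<le> (\<Sum>i<n. es ! i * ((P\<^sup>T *\<^sub>v z) $ i)\<^sup>2)"
  proof (intro sum_mono)
    fix i assume "i \<in> {..<n}"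
    then show "es ! 1 * ((P\<^sup>T *\<^sub>v z) $ i)\<^sup>2 \<le> es ! i * ((P\<^sup>T *\<^sub>v z) $ i)\<^sup>2"
      using z0 spec(1,2) by (cases "i = 0") (auto intro!: mult_right_mono sorted_nth_mono)
  qed
  also have "\<dots> = z \<bullet> (A *\<^sub>v z)" by (rule qf[OF z, symmetric])
  also have "\<dots> \<le> \<beta>\<^sup>2 * (c * (x \<bullet> x))"
    unfolding zAz using bound by (intro mult_left_mono) auto
  also have "\<dots> \<le> c * (z \<bullet> z)"
    unfolding zz using c scalar_prod_self_pos[OF u] by (simp add: algebra_simps)
  finally show ?thesis using zpos unfolding es_def by simp
qed

section \<open>The second Laplacian eigenvalue\<close>

text \<open>The sum runs over ordered pairs, hence counts every edge twice.\<close>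

definition dirichlet :: "(nat \<times> nat) set \<Rightarrow> (nat \<Rightarrow> real) \<Rightarrow> real" where
  "dirichlet E x = (\<Sum>(p, q)\<in>E. (x p - x q)\<^sup>2)"

lemma laplacian_carrier: "laplacian n E \<in> carrier_mat n n"
  by (simp add: laplacian_def)

lemma laplacian_mult_vec:
  assumes G: "simple_graph n E" and i: "i < n"
  shows "(laplacian n E *\<^sub>v vec n x) $ i = (\<Sum>j\<in>{j. (i, j) \<in> E}. x i - x j)"
proof -
  have sub: "{j. (i, j) \<in> E} \<subseteq> {..<n} - {i}"
    using G unfolding simple_graph_def by auto
  have "(laplacian n E *\<^sub>v vec n x) $ i =
      (\<Sum>j<n. (if i = j then real (degree E i) else if (i, j) \<in> E then -1 else 0) * x j)"
    using i by (simp add: laplacian_def scalar_prod_def atLeast0LessThan)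
  also have "\<dots> = real (degree E i) * x i + (\<Sum>j\<in>{..<n} - {i}. if (i, j) \<in> E then - x j else 0)"
    using i by (subst sum.remove[of _ i]) (auto intro!: sum.cong split: if_splits)
  also have "(\<Sum>j\<in>{..<n} - {i}. if (i, j) \<in> E then - x j else 0) = (\<Sum>j\<in>{j. (i, j) \<in> E}. - x j)"
    by (rule sum.mono_neutral_cong_right) (use sub in auto)
  finally show ?thesis by (simp add: degree_def sum_subtractf sum_negf)
qed

text \<open>Reversing all ordered pairs maps the symmetric \<open>E\<close> onto itself; adding the
  two resulting expressions for the form \<open>S\<close> completes the squares.\<close>

lemma laplacian_quadratic_form:
  assumes G: "simple_graph n E"
  shows "vec n x \<bullet> (laplacian n E *\<^sub>v vec n x) = dirichlet E x / 2"
proof -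
  have fin: "finite {j. (i, j) \<in> E}" for i
    using G unfolding simple_graph_def by (auto intro: finite_subset[of _ "{0..<n}"])
  have E: "E = (SIGMA i:{..<n}. {j. (i, j) \<in> E})"
    using G unfolding simple_graph_def by auto
  define S where "S = (\<Sum>(i, j)\<in>E. x i * (x i - x j))"
  have "vec n x \<bullet> (laplacian n E *\<^sub>v vec n x) = (\<Sum>i<n. x i * (\<Sum>j\<in>{j. (i, j) \<in> E}. x i - x j))"
    using laplacian_mult_vec[OF G] laplacian_carrier[of n E]
    by (simp add: scalar_prod_def atLeast0LessThan)
  also have "\<dots> = S"
    unfolding S_def by (subst E, subst sum.Sigma[symmetric]) (auto simp: fin sum_distrib_left)
  finally have 1: "vec n x \<bullet> (laplacian n E *\<^sub>v vec n x) = S" .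
  have "S = (\<Sum>(i, j)\<in>E. x j * (x j - x i))"
    unfolding S_def
    by (rule sum.reindex_bij_witness[of _ prod.swap prod.swap])
      (use G in \<open>auto simp: simple_graph_def sym_def\<close>)
  then have "S + S = (\<Sum>(i, j)\<in>E. x i * (x i - x j)) + (\<Sum>(i, j)\<in>E. x j * (x j - x i))"
    by (simp add: S_def)
  also have "\<dots> = dirichlet E x"
    unfolding dirichlet_def case_prod_unfold sum.distrib[symmetric]
    by (rule sum.cong) (auto simp: power2_eq_square algebra_simps)
  finally show ?thesis using 1 by simp
qed

lemma laplacian_symmetric: "simple_graph n E \<Longrightarrow> (laplacian n E)\<^sup>T = laplacian n E"
  by (rule eq_matI) (auto simp: laplacian_def simple_graph_def sym_def)

lemma vec_const_scalar_prod: "vec n x \<bullet> vec n (\<lambda>_. 1) = (\<Sum>i<n. x i :: real)"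
  by (simp add: scalar_prod_def atLeast0LessThan)

lemma alg_conn_ge:
  assumes G: "simple_graph n E" and n: "2 \<le> n"
    and bound: "\<And>x. (\<Sum>i<n. x i) = 0 \<Longrightarrow> c * (\<Sum>i<n. (x i)\<^sup>2) \<le> dirichlet E x / 2"
  shows "c \<le> alg_conn n E"
  unfolding alg_conn_def laplacian_spectrum_def
proof (rule second_eigenvalue_ge[OF laplacian_carrier laplacian_symmetric[OF G] n, of "vec n (\<lambda>_. 1)"])
  fix v :: "real vec" assume v: "v \<in> carrier_vec n" and "v \<bullet> vec n (\<lambda>_. 1) = 0"
  moreover have "v \<bullet> vec n (\<lambda>_. 1) = (\<Sum>i<n. v $ i)"
    by (auto simp: scalar_prod_def atLeast0LessThan intro!: sum.cong)
  ultimately have "(\<Sum>i<n. v $ i) = 0" by simp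
  from bound[OF this] have "c * (v \<bullet> v) \<le> dirichlet E (($) v) / 2"
    by (simp add: scalar_prod_self_eq[OF v])
  also have "\<dots> = vec n (($) v) \<bullet> (laplacian n E *\<^sub>v vec n (($) v))"
    by (rule laplacian_quadratic_form[OF G, symmetric])
  also have "vec n (($) v) = v" using v by (intro eq_vecI) auto
  finally show "c * (v \<bullet> v) \<le> v \<bullet> (laplacian n E *\<^sub>v v)" .
qed simp

text \<open>Phrased with the variance so that test functions need not be centred: subtracting the
  mean does not change the energy.\<close>

lemma alg_conn_le:
  assumes G: "simple_graph n E" and n: "2 \<le> n" and c: "0 \<le> c"
    and pos: "(\<Sum>i<n. (x i - (\<Sum>j<n. x j) / n)\<^sup>2) > 0"
    and bound: "dirichlet E x / 2 \<le> c * (\<Sum>i<n. (x i - (\<Sum>j<n. x j) / n)\<^sup>2)"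
  shows "alg_conn n E \<le> c"
proof -
  define m where "m = (\<Sum>j<n. x j) / n"
  define v where "v = vec n (\<lambda>i. x i - m)"
  have v: "v \<in> carrier_vec n" by (simp add: v_def)
  have vv: "v \<bullet> v = (\<Sum>i<n. (x i - m)\<^sup>2)"
    unfolding scalar_prod_self_eq[OF v] by (simp add: v_def)
  have "(\<Sum>i<n. x i - m) = 0" using n by (simp add: sum_subtractf m_def)
  then have vu: "v \<bullet> vec n (\<lambda>_. 1) = 0" unfolding v_def vec_const_scalar_prod .
  have "dirichlet E (\<lambda>i. x i - m) = dirichlet E x" by (simp add: dirichlet_def)
  then have vLv: "v \<bullet> (laplacian n E *\<^sub>v v) = dirichlet E x / 2"
    unfolding v_def laplacian_quadratic_form[OF G] by simp
  have Lu: "laplacian n E *\<^sub>v vec n (\<lambda>_. 1) = 0\<^sub>v n"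
    using laplacian_mult_vec[OF G] laplacian_carrier[of n E] by (intro eq_vecI) auto
  have u0: "vec n (\<lambda>_. 1 :: real) \<noteq> 0\<^sub>v n"
    using n by (auto dest!: arg_cong[of _ _ "\<lambda>v. v $ 0"])
  have v0: "v \<noteq> 0\<^sub>v n" using vv pos by (auto simp: m_def)
  show ?thesis
    unfolding alg_conn_def laplacian_spectrum_def
    by (rule second_eigenvalue_le[OF laplacian_carrier laplacian_symmetric[OF G] n _ u0 Lu v v0 vu c])
      (use bound in \<open>simp_all add: vLv vv m_def\<close>)
qed

section \<open>The Poincare inequality of a path\<close>

lemma weighted_am_gm:
  fixes a b r :: real
  assumes "r > 0"
  shows "2 * a * b \<le> a\<^sup>2 * r + b\<^sup>2 / r"
proof -
  have "0 \<le> (a * r - b)\<^sup>2 / r" using assms by simp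
  also have "\<dots> = a\<^sup>2 * r + b\<^sup>2 / r - 2 * a * b"
    using assms by (simp add: power2_eq_square field_simps)
  finally show ?thesis by simp
qed

lemma weighted_square_sum_le:
  fixes a b t :: real
  assumes "t > 0"
  shows "(a + b)\<^sup>2 \<le> (1 + t) * a\<^sup>2 + (1 + 1 / t) * b\<^sup>2"
  using weighted_am_gm[OF assms, of a b] by (simp add: power2_eq_square algebra_simps)

lemma weighted_square_sum_ge:
  fixes a b t :: real
  assumes "t > 0"
  shows "(1 - t) * a\<^sup>2 - b\<^sup>2 / t \<le> (a + b)\<^sup>2"
proof -
  have "- (2 * a * b) \<le> a\<^sup>2 * t + b\<^sup>2 / t"
    using weighted_am_gm[OF assms, of a "- b"] by simp
  moreover have "0 \<le> b\<^sup>2" by simp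
  ultimately show ?thesis by (simp only: power2_sum left_diff_distrib mult_1 mult.commute[of t])
qed

text \<open>The sine is a positive supersolution, and the bound is the discrete ground state
  (Picone) representation with respect to it.\<close>

lemma dirichlet_path_ineq:
  fixes h :: "nat \<Rightarrow> real"
  assumes M: "M \<ge> 1" and h0: "h 0 = 0" and hM: "h M = 0"
  shows "(2 - 2 * cos (pi / M)) * (\<Sum>j<M. (h j)\<^sup>2) \<le> (\<Sum>j<M. (h (Suc j) - h j)\<^sup>2)"
proof -
  define s where "s j = sin (pi * j / M)" for j :: nat
  have spos: "s j > 0" if "0 < j" "j < M" for j
    unfolding s_def by (rule sin_gt_zero) (use that in \<open>auto simp: field_simps\<close>)
  have s0: "s 0 = 0" and sM: "s M = 0" using M by (auto simp: s_def)
  have rec: "s (Suc j) + s (j - 1) = 2 * cos (pi / M) * s j" if "0 < j" for j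
  proof -
    have "pi * real (Suc j) / M = pi * j / M + pi / M"
      "pi * real (j - 1) / M = pi * j / M - pi / M"
      using that M by (auto simp: field_simps of_nat_diff)
    then show ?thesis unfolding s_def by (simp only: sin_add sin_diff) simp
  qed
  \<comment> \<open>\<open>u j\<close> is the share of vertex \<open>j\<close> in the edge to
    \<open>Suc j\<close>, and \<open>v j\<close> its share in the edge to \<open>j - 1\<close>.
    AM-GM bounds the two shares of an edge by its energy, and \<open>rec\<close> makes the two
    shares of an interior vertex add up to the eigenvalue times \<open>(h j)^2\<close>. At
    \<open>0\<close> and \<open>M\<close>, where \<open>s\<close> vanishes, the shares vanish
    because \<open>h\<close> does.\<close>
  define u where "u j = (h j)\<^sup>2 * (1 - s (Suc j) / s j)" for j
  define v where "v j = (h j)\<^sup>2 * (1 - s (j - 1) / s j)" for j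
  have edge: "u j + v (Suc j) \<le> (h (Suc j) - h j)\<^sup>2" if j: "j < M" for j
  proof -
    consider "j = 0" | "j > 0" "Suc j = M" | "j > 0" "Suc j < M" using j by linarith
    then show ?thesis
    proof cases
      case 3
      have "s (Suc j) / s j > 0" using spos[of j] spos[of "Suc j"] 3 by simp
      from weighted_am_gm[OF this, of "h j" "h (Suc j)"] show ?thesis
        by (simp add: u_def v_def power2_eq_square algebra_simps)
    qed (auto simp: u_def v_def h0 hM s0 sM)
  qed
  have "(2 - 2 * cos (pi / M)) * (\<Sum>j<M. (h j)\<^sup>2) = (\<Sum>j<M. u j + v j)"
    unfolding sum_distrib_left
  proof (rule sum.cong[OF refl])
    fix j assume "j \<in> {..<M}"
    then show "(2 - 2 * cos (pi / M)) * (h j)\<^sup>2 = u j + v j"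
    proof (cases "j = 0")
      case False
      with \<open>j \<in> {..<M}\<close> have sj: "s j > 0" using spos by auto
      have "u j + v j = (h j)\<^sup>2 * (2 - (s (Suc j) + s (j - 1)) / s j)"
        unfolding u_def v_def by (simp add: algebra_simps add_divide_distrib)
      then show ?thesis using rec[of j] False sj by simp
    qed (simp add: u_def v_def h0)
  qed
  also have "\<dots> = (\<Sum>j<M. u j) + (\<Sum>j<M. v j)" by (rule sum.distrib)
  also have "(\<Sum>j<M. v j) = (\<Sum>j<M. v (Suc j))"
    using sum.lessThan_Suc_shift[of v M] by (simp add: v_def h0 hM)
  also have "(\<Sum>j<M. u j) + \<dots> = (\<Sum>j<M. u j + v (Suc j))" by (rule sum.distrib[symmetric])
  also have "\<dots> \<le> (\<Sum>j<M. (h (Suc j) - h j)\<^sup>2)" using edge by (intro sum_mono) auto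
  finally show ?thesis .
qed

lemma path_eigenvalue_pos: "M \<ge> 2 \<Longrightarrow> 2 - 2 * cos (pi / real M) > 0"
proof -
  assume "M \<ge> 2"
  then have "cos (pi / real M) < cos 0"
    by (intro cos_monotone_0_pi) (auto simp: field_simps)
  then show ?thesis by simp
qed

text \<open>Duality: the partial sums of a mean-zero function vanish at both ends, so its Poincare
  inequality follows from the Dirichlet inequality for the partial sums.\<close>

lemma path_poincare:
  fixes z :: "nat \<Rightarrow> real"
  assumes M: "Suc m \<ge> 2" and mean: "(\<Sum>j<Suc m. z j) = 0"
  shows "(2 - 2 * cos (pi / Suc m)) * (\<Sum>j<Suc m. (z j)\<^sup>2) \<le> (\<Sum>j<m. (z (Suc j) - z j)\<^sup>2)"
proof -
  define lam where "lam = 2 - 2 * cos (pi / Suc m)"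
  have lam: "lam > 0" unfolding lam_def by (rule path_eigenvalue_pos[OF M])
  define h where "h j = (\<Sum>i<j. z i)" for j
  define Z where "Z = (\<Sum>j<Suc m. (z j)\<^sup>2)"
  define G where "G = (\<Sum>j<m. (z (Suc j) - z j)\<^sup>2)"
  have "(\<Sum>j<Suc m. (h (Suc j) - h j)\<^sup>2) = Z" by (simp add: Z_def h_def)
  with dirichlet_path_ineq[of "Suc m" h] mean
  have H: "lam * (\<Sum>j<Suc m. (h j)\<^sup>2) \<le> Z" unfolding lam_def by (simp add: h_def)
  \<comment> \<open>Summation by parts; the boundary term disappears at \<open>k = m\<close> because
    \<open>h (Suc m) = 0\<close>.\<close>
  have parts: "(\<Sum>j<Suc k. (z j)\<^sup>2) = h (Suc k) * z k - (\<Sum>j<k. h (Suc j) * (z (Suc j) - z j))" for k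
    by (induct k) (simp_all add: h_def power2_eq_square algebra_simps)
  have "h (Suc m) = 0" using mean by (simp add: h_def)
  then have "Z = (\<Sum>j<m. - (h (Suc j) * (z (Suc j) - z j)))"
    unfolding Z_def parts by (simp add: sum_negf)
  \<comment> \<open>With the weight \<open>lam\<close>, the first half of the AM-GM bound is at most
    \<open>Z / 2\<close> by \<open>H\<close> and is absorbed on the left.\<close>
  also have "\<dots> \<le> (\<Sum>j<m. ((h (Suc j))\<^sup>2 * lam + (z (Suc j) - z j)\<^sup>2 / lam) / 2)"
  proof (rule sum_mono)
    fix j
    define d where "d = z (Suc j) - z j"
    show "- (h (Suc j) * (z (Suc j) - z j)) \<le> ((h (Suc j))\<^sup>2 * lam + (z (Suc j) - z j)\<^sup>2 / lam) / 2"
      unfolding d_def[symmetric] using weighted_am_gm[OF lam, of "h (Suc j)" "- d"] by simp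
  qed
  also have "\<dots> = (lam * (\<Sum>j<m. (h (Suc j))\<^sup>2) + G / lam) / 2"
    by (simp add: G_def sum.distrib sum_divide_distrib sum_distrib_left add_divide_distrib mult.commute)
  also have "(\<Sum>j<m. (h (Suc j))\<^sup>2) = (\<Sum>j<Suc m. (h j)\<^sup>2)"
    by (subst sum.lessThan_Suc_shift) (simp add: h_def)
  also have "(lam * \<dots> + G / lam) / 2 \<le> (Z + G / lam) / 2"
    using H by simp
  finally have "Z \<le> G / lam" by simp
  then show ?thesis using lam unfolding Z_def G_def lam_def[symmetric] by (simp add: field_simps)
qed

lemma path_poincare_center:
  fixes y :: "nat \<Rightarrow> real"
  assumes M: "Suc m \<ge> 2"
  shows "\<exists>c. (2 - 2 * cos (pi / Suc m)) * (\<Sum>j<Suc m. (y j - c)\<^sup>2) \<le> (\<Sum>j<m. (y (Suc j) - y j)\<^sup>2)"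
proof -
  define c where "c = (\<Sum>j<Suc m. y j) / Suc m"
  have "(\<Sum>j<Suc m. y j - c) = (\<Sum>j<Suc m. y j) - Suc m * c" by (subst sum_subtractf) simp
  also have "\<dots> = 0" by (simp add: c_def del: of_nat_Suc)
  finally have "(\<Sum>j<Suc m. y j - c) = 0" .
  from path_poincare[OF M this] show ?thesis by auto
qed

text \<open>Doubling the two end vertices of the path makes room for end blocks of more than five
  vertices.\<close>

lemma path_poincare_doubled_ends:
  fixes y :: "nat \<Rightarrow> real"
  shows "\<exists>c. (2 - 2 * cos (pi / (real k + 3))) *
      ((\<Sum>j<Suc k. (y j - c)\<^sup>2) + (y 0 - c)\<^sup>2 + (y k - c)\<^sup>2) \<le> (\<Sum>j<k. (y (Suc j) - y j)\<^sup>2)"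
proof -
  \<comment> \<open>Each duplicated end is joined to its copy by an edge of zero increment, so the
    path grows to \<open>k + 3\<close> vertices without gaining energy.\<close>
  define y' where "y' j = (if j = 0 then y 0 else if j = k + 2 then y k else y (j - 1))" for j
  have "(\<Sum>j<k + 3. g (y' j)) = g (y 0) + (\<Sum>j<Suc k. g (y j)) + g (y k)" for g :: "real \<Rightarrow> real"
  proof -
    have "(\<Sum>j<k + 3. g (y' j)) = (\<Sum>j<Suc (Suc k). g (y' j)) + g (y' (k + 2))"
      by (simp add: numeral_3_eq_3)
    also have "(\<Sum>j<Suc (Suc k). g (y' j)) = g (y' 0) + (\<Sum>j<Suc k. g (y' (Suc j)))"
      by (rule sum.lessThan_Suc_shift)
    also have "(\<Sum>j<Suc k. g (y' (Suc j))) = (\<Sum>j<Suc k. g (y j))"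
      by (rule sum.cong) (auto simp: y'_def)
    finally show ?thesis by (simp add: y'_def)
  qed
  note S = this
  have D: "(\<Sum>j<Suc (Suc k). (y' (Suc j) - y' j)\<^sup>2) = (\<Sum>j<k. (y (Suc j) - y j)\<^sup>2)"
  proof -
    have "(\<Sum>j<Suc (Suc k). (y' (Suc j) - y' j)\<^sup>2)
        = (y' 1 - y' 0)\<^sup>2 + (\<Sum>j<k. (y' (Suc (Suc j)) - y' (Suc j))\<^sup>2) + (y' (Suc (Suc k)) - y' (Suc k))\<^sup>2"
      by (subst sum.lessThan_Suc, subst sum.lessThan_Suc_shift) simp
    also have "(\<Sum>j<k. (y' (Suc (Suc j)) - y' (Suc j))\<^sup>2) = (\<Sum>j<k. (y (Suc j) - y j)\<^sup>2)"
      by (rule sum.cong) (auto simp: y'_def)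
    finally show ?thesis by (simp add: y'_def)
  qed
  have e: "Suc (k + 2) = k + 3" "k + 2 = Suc (Suc k)" by auto
  from path_poincare_center[of "k + 2" y'] obtain c where
    "(2 - 2 * cos (pi / (real k + 3))) * (\<Sum>j<k + 3. (y' j - c)\<^sup>2) \<le> (\<Sum>j<Suc (Suc k). (y' (Suc j) - y' j)\<^sup>2)"
    unfolding e(1) by (auto simp: add.commute)
  then show ?thesis unfolding S[of "\<lambda>t. (t - c)\<^sup>2"] D by (auto simp: algebra_simps intro!: exI[of _ c])
qed

section \<open>The blocks\<close>

lemma finite_sym_edges: "finite (sym_edges l)"
proof -
  have "sym_edges l = set l \<union> prod.swap ` set l" by (force simp: sym_edges_def)
  then show ?thesis by simp
qed

lemma dirichlet_sym_edges:
  assumes "distinct (l @ map prod.swap l)"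
  shows "dirichlet (sym_edges l) g = 2 * (\<Sum>(p, q)\<leftarrow>l. (g p - g q)\<^sup>2)"
proof -
  have "sym_edges l = set (l @ map prod.swap l)" by (force simp: sym_edges_def)
  then have "dirichlet (sym_edges l) g = (\<Sum>(p, q)\<leftarrow>l @ map prod.swap l. (g p - g q)\<^sup>2)"
    unfolding dirichlet_def using sum.distinct_set_conv_list[OF assms] by simp
  also have "\<dots> = 2 * (\<Sum>(p, q)\<leftarrow>l. (g p - g q)\<^sup>2)"
    by (simp add: o_def case_prod_unfold power2_commute)
  finally show ?thesis .
qed

lemma dirichlet_nonneg: "0 \<le> dirichlet F g"
  unfolding dirichlet_def by (intro sum_nonneg) auto

lemma edge_le_sqrt_dirichlet:
  assumes "finite F" "(p, q) \<in> F"
  shows "\<bar>g p - g q\<bar> \<le> sqrt (dirichlet F g)"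
proof -
  have "(g p - g q)\<^sup>2 \<le> dirichlet F g"
    unfolding dirichlet_def using member_le_sum[OF assms(2), of "\<lambda>(p, q). (g p - g q)\<^sup>2"] assms(1) by auto
  then show ?thesis using real_sqrt_le_mono by fastforce
qed

text \<open>The reference vertex of a block: the cut vertex towards the preceding block in the
  middle of the chain, the only cut vertex in an end block. Hence blocks 0 and 1 have the same root
  in the graph.\<close>

definition block_root :: "blk \<Rightarrow> nat" where
  "block_root B = (if B = M0 then vu else vw)"

lemma vw_notin_M0: "vw \<notin> fst M0"
  by (simp add: M0_def)

lemma vw_in_end_block: "B \<in> end_blocks \<Longrightarrow> vw \<in> fst B"
  by (auto simp: end_blocks_def D0_def D1_def D2_def D3_def D4_def)

lemma end_block_neq_M0: "B \<in> end_blocks \<Longrightarrow> B \<noteq> M0"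
  using vw_notin_M0 vw_in_end_block by blast

lemma block_vertices:
  assumes "B \<in> insert M0 end_blocks"
  shows "finite (fst B)" "6 \<le> card (fst B)" "card (fst B) \<le> 10"
  using assms
  by (auto simp: end_blocks_def M0_def D0_def D1_def D2_def D3_def D4_def)

lemma block_edges:
  assumes "B \<in> insert M0 end_blocks"
  shows "finite (snd B)" "snd B \<subseteq> fst B \<times> fst B" "(p, p) \<notin> snd B"
proof -
  show "finite (snd B)"
    using assms by (auto simp: end_blocks_def M0_def D0_def D1_def D2_def D3_def D4_def finite_sym_edges)
  show "snd B \<subseteq> fst B \<times> fst B" "(p, p) \<notin> snd B"
    using assms
    by (auto simp: end_blocks_def M0_def D0_def D1_def D2_def D3_def D4_def sym_edges_def
        K4_abcd_def K5_minus_de_def)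
qed

lemma M0_dirichlet:
  "dirichlet (snd M0) g = 2 * ((g 0 - g 1)\<^sup>2 + (g 0 - g 2)\<^sup>2 + (g 0 - g 3)\<^sup>2 + (g 1 - g 2)\<^sup>2
    + (g 1 - g 3)\<^sup>2 + (g 2 - g 3)\<^sup>2 + (g vu - g 0)\<^sup>2 + (g vu - g 1)\<^sup>2 + (g vv - g 2)\<^sup>2 + (g vv - g 3)\<^sup>2)"
  unfolding M0_def snd_conv by (subst dirichlet_sym_edges) (simp_all add: K4_abcd_def)

text \<open>Each square is bounded below by its tangent at the drop of the equilibrium potential, which is
  2/5 of the total voltage on the outer and 1/5 on the inner edges; the constant is twice the
  effective conductance 4/5 of \<open>M\<^sub>0\<close>.\<close>

lemma M0_dirichlet_ge: "8 / 5 * (g vv - g vu)\<^sup>2 \<le> dirichlet (snd M0) g"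
proof -
  define D where "D = g vv - g vu"
  have tangent: "2 * s * t - s\<^sup>2 \<le> t\<^sup>2" for s t :: real
    using zero_le_power2[of "s - t"] by (simp add: power2_eq_square algebra_simps)
  have "8 / 5 * D\<^sup>2 \<le> 2 * ((g 0 - g vu)\<^sup>2 + (g 1 - g vu)\<^sup>2 + (g vv - g 2)\<^sup>2 + (g vv - g 3)\<^sup>2
      + (g 2 - g 0)\<^sup>2 + (g 3 - g 0)\<^sup>2 + (g 2 - g 1)\<^sup>2 + (g 3 - g 1)\<^sup>2)"
  proof -
    have "4 / 5 * D\<^sup>2 = (\<Sum>t\<leftarrow>[g 0 - g vu, g 1 - g vu, g vv - g 2, g vv - g 3]. 2 * (2 / 5 * D) * t - (2 / 5 * D)\<^sup>2)
      + (\<Sum>t\<leftarrow>[g 2 - g 0, g 3 - g 0, g 2 - g 1, g 3 - g 1]. 2 * (1 / 5 * D) * t - (1 / 5 * D)\<^sup>2)"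
      by (simp add: D_def power2_eq_square field_simps)
    also have "\<dots> \<le> (\<Sum>t\<leftarrow>[g 0 - g vu, g 1 - g vu, g vv - g 2, g vv - g 3]. t\<^sup>2)
      + (\<Sum>t\<leftarrow>[g 2 - g 0, g 3 - g 0, g 2 - g 1, g 3 - g 1]. t\<^sup>2)"
      by (intro add_mono sum_list_mono tangent)
    finally show ?thesis by simp
  qed
  \<comment> \<open>The two dropped edges, inside \<open>0, 1\<close> and inside
    \<open>2, 3\<close>, join vertices of equal equilibrium potential, so sharpness is not
    lost.\<close>
  also have "\<dots> \<le> dirichlet (snd M0) g"
    unfolding M0_dirichlet
    using zero_le_power2[of "g 0 - g 1"] zero_le_power2[of "g 2 - g 3"]
    by (simp add: power2_commute)
  finally show ?thesis unfolding D_def .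
qed

text \<open>The edges listed in each case lead from the root to every vertex in at most four steps,
  and along an edge \<open>g\<close> changes by at most the square root of the energy. The factor 9,
  squared to 81, is generous: only a common constant is wanted.\<close>

lemma block_oscillation:
  assumes B: "B \<in> insert M0 end_blocks" and p: "p \<in> fst B"
  shows "(g p - g (block_root B))\<^sup>2 \<le> 81 * dirichlet (snd B) g"
proof -
  define s where "s = sqrt (dirichlet (snd B) g)"
  have s0: "0 \<le> s" by (simp add: s_def dirichlet_nonneg)
  have e: "\<bar>g p - g q\<bar> \<le> s" if "(p, q) \<in> snd B" for p q
    unfolding s_def by (rule edge_le_sqrt_dirichlet[OF block_edges(1)[OF B] that])
  have "B = M0 \<or> B = D0 \<or> B = D1 \<or> B = D2 \<or> B = D3 \<or> B = D4"
    using B by (auto simp: end_blocks_def)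
  then have "\<bar>g p - g (block_root B)\<bar> \<le> 9 * s"
  proof (elim disjE)
    assume [simp]: "B = M0"
    have "block_root B = vu" by (simp add: block_root_def)
    moreover have "\<bar>g vu - g 0\<bar> \<le> s" "\<bar>g vu - g 1\<bar> \<le> s" "\<bar>g 0 - g 2\<bar> \<le> s" "\<bar>g 0 - g 3\<bar> \<le> s" "\<bar>g vv - g 2\<bar> \<le> s"
      by (rule e; simp add: M0_def sym_edges_def K4_abcd_def)+
    moreover have "p \<in> {vu,0,1,2,3,vv}" using p by (simp add: M0_def)
    ultimately show ?thesis using s0 by (auto simp: abs_le_iff)
  next
    assume [simp]: "B = D0"
    have "block_root B = vw" using B end_block_neq_M0[of D0] by (simp add: block_root_def end_blocks_def)
    moreover have "\<bar>g vw - g 3\<bar> \<le> s" "\<bar>g vw - g 4\<bar> \<le> s" "\<bar>g 0 - g 3\<bar> \<le> s" "\<bar>g 1 - g 3\<bar> \<le> s" "\<bar>g 2 - g 3\<bar> \<le> s"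
      by (rule e; simp add: D0_def sym_edges_def K4_abcd_def K5_minus_de_def)+
    moreover have "p \<in> {0,1,2,3,4,vw}" using p by (simp add: D0_def)
    ultimately show ?thesis using s0 by (auto simp: abs_le_iff)
  next
    assume [simp]: "B = D1"
    have "block_root B = vw" using B end_block_neq_M0[of D1] by (simp add: block_root_def end_blocks_def)
    moreover have "\<bar>g vw - g 4\<bar> \<le> s" "\<bar>g vw - g 5\<bar> \<le> s" "\<bar>g 4 - g 0\<bar> \<le> s" "\<bar>g 4 - g 1\<bar> \<le> s"
      "\<bar>g 5 - g 2\<bar> \<le> s" "\<bar>g 5 - g 3\<bar> \<le> s"
      by (rule e; simp add: D1_def sym_edges_def K4_abcd_def)+
    moreover have "p \<in> {0,1,2,3,4,5,vw}" using p by (simp add: D1_def)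
    ultimately show ?thesis using s0 by (auto simp: abs_le_iff)
  next
    assume [simp]: "B = D2"
    have "block_root B = vw" using B end_block_neq_M0[of D2] by (simp add: block_root_def end_blocks_def)
    moreover have "\<bar>g vw - g 5\<bar> \<le> s" "\<bar>g vw - g 6\<bar> \<le> s" "\<bar>g 5 - g 2\<bar> \<le> s" "\<bar>g 5 - g 4\<bar> \<le> s" "\<bar>g 6 - g 3\<bar> \<le> s"
      "\<bar>g 4 - g 0\<bar> \<le> s" "\<bar>g 4 - g 1\<bar> \<le> s"
      by (rule e; simp add: D2_def sym_edges_def K4_abcd_def)+
    moreover have "p \<in> {0,1,2,3,4,5,6,vw}" using p by (simp add: D2_def)
    ultimately show ?thesis using s0 by (auto simp: abs_le_iff)
  next
    assume [simp]: "B = D3"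
    have "block_root B = vw" using B end_block_neq_M0[of D3] by (simp add: block_root_def end_blocks_def)
    moreover have "\<bar>g vw - g 6\<bar> \<le> s" "\<bar>g vw - g 7\<bar> \<le> s" "\<bar>g 6 - g 4\<bar> \<le> s" "\<bar>g 6 - g 5\<bar> \<le> s"
      "\<bar>g 4 - g 0\<bar> \<le> s" "\<bar>g 4 - g 1\<bar> \<le> s" "\<bar>g 5 - g 2\<bar> \<le> s" "\<bar>g 5 - g 3\<bar> \<le> s"
      by (rule e; simp add: D3_def sym_edges_def K4_abcd_def)+
    moreover have "p \<in> {0,1,2,3,4,5,6,7,vw}" using p by (simp add: D3_def)
    ultimately show ?thesis using s0 by (auto simp: abs_le_iff)
  next
    assume [simp]: "B = D4"
    have "block_root B = vw" using B end_block_neq_M0[of D4] by (simp add: block_root_def end_blocks_def)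
    moreover have "\<bar>g vw - g 7\<bar> \<le> s" "\<bar>g vw - g 8\<bar> \<le> s" "\<bar>g 5 - g 7\<bar> \<le> s" "\<bar>g 6 - g 7\<bar> \<le> s" "\<bar>g 3 - g 5\<bar> \<le> s"
      "\<bar>g 4 - g 6\<bar> \<le> s" "\<bar>g 0 - g 3\<bar> \<le> s" "\<bar>g 1 - g 3\<bar> \<le> s" "\<bar>g 2 - g 3\<bar> \<le> s"
      by (rule e; simp add: D4_def sym_edges_def K4_abcd_def K5_minus_de_def)+
    moreover have "p \<in> {0,1,2,3,4,5,6,7,8,vw}" using p by (simp add: D4_def)
    ultimately show ?thesis using s0 by (auto simp: abs_le_iff)
  qed
  then have "(g p - g (block_root B))\<^sup>2 \<le> (9 * s)\<^sup>2" by (rule abs_le_square_iff[THEN iffD1, OF order_trans]) simp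
  also have "\<dots> = 81 * dirichlet (snd B) g"
    by (simp add: s_def power_mult_distrib dirichlet_nonneg)
  finally show ?thesis .
qed

lemma dirichlet_img_edges:
  assumes "inj_on f (fst B)" "snd B \<subseteq> fst B \<times> fst B"
  shows "dirichlet (img_edges f B) x = dirichlet (snd B) (x \<circ> f)"
proof -
  have "inj_on (\<lambda>(p, q). (f p, f q)) (snd B)"
    using inj_on_subset[OF map_prod_inj_on[OF assms(1,1)] assms(2)] by (simp add: map_prod_def)
  then show ?thesis
    unfolding dirichlet_def img_edges_def by (simp add: sum.reindex case_prod_unfold)
qed

section \<open>Chains of blocks and the lower bound\<close>

locale block_chain =
  fixes n :: nat and E :: "(nat \<times> nat) set" and k :: nat
    and bl :: "nat \<Rightarrow> blk" and f :: "nat \<Rightarrow> nat \<Rightarrow> nat"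
  assumes graph: "simple_graph n E"
    and k: "2 \<le> k"
    and ends: "bl 0 \<in> end_blocks" "bl (k - 1) \<in> end_blocks"
    and middle: "0 < i \<Longrightarrow> i < k - 1 \<Longrightarrow> bl i = M0"
    and inj: "i < k \<Longrightarrow> inj_on (f i) (fst (bl i))"
    and vertices: "{0..<n} = (\<Union>i<k. f i ` fst (bl i))"
    and edges: "E = (\<Union>i<k. img_edges (f i) (bl i))"
    and glue: "i + 1 < k \<Longrightarrow>
      f i (if i = 0 then vw else vv) = f (i + 1) (if i + 1 = k - 1 then vw else vu)"
    and meet: "i + 1 < k \<Longrightarrow>
      f i ` fst (bl i) \<inter> f (i + 1) ` fst (bl (i + 1)) = {f i (if i = 0 then vw else vv)}"
    and apart: "i + 1 < j \<Longrightarrow> j < k \<Longrightarrow> f i ` fst (bl i) \<inter> f j ` fst (bl j) = {}"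
begin

text \<open>Label in block \<open>i\<close> of the cut vertex shared with block
  \<open>i + 1\<close>; meaningful for \<open>i + 1 < k\<close>.\<close>

definition exit_label :: "nat \<Rightarrow> nat" where
  "exit_label i = (if i = 0 then vw else vv)"

lemma block_cases: "i < k \<Longrightarrow> bl i \<in> insert M0 end_blocks"
  using ends middle[of i] by (cases "i = 0"; cases "i = k - 1") auto

lemma root_label:
  assumes "i < k"
  shows "block_root (bl i) = (if i = 0 \<or> i = k - 1 then vw else vu)"
  using assms middle[of i] end_block_neq_M0[OF ends(1)] end_block_neq_M0[OF ends(2)]
  by (cases "0 < i \<and> i < k - 1") (auto simp: block_root_def)

lemma glue_root:
  assumes "i + 1 < k"
  shows "f i (exit_label i) = f (i + 1) (block_root (bl (i + 1)))"
  using glue[OF assms] assms by (simp add: exit_label_def root_label)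

lemma exit_in: "i + 1 < k \<Longrightarrow> exit_label i \<in> fst (bl i)"
  using ends vw_in_end_block middle[of i] by (auto simp: exit_label_def M0_def)

lemma root_in: "i < k \<Longrightarrow> block_root (bl i) \<in> fst (bl i)"
  using block_cases[of i] vw_in_end_block[of "bl i"] by (auto simp: block_root_def M0_def)

text \<open>The vertices of block \<open>i\<close> without the cut vertex shared with block \<open>i + 1\<close>, so that every
  vertex of the graph is counted exactly once.\<close>

definition cell :: "nat \<Rightarrow> nat set" where
  "cell i = (if i + 1 < k then fst (bl i) - {exit_label i} else fst (bl i))"

lemma cell_subset: "cell i \<subseteq> fst (bl i)"
  by (auto simp: cell_def)

lemma finite_cell: "i < k \<Longrightarrow> finite (cell i)"
  using block_vertices(1)[OF block_cases] cell_subset finite_subset by blast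

lemma cell_disjoint:
  assumes "i < k" "j < k" "i \<noteq> j"
  shows "f i ` cell i \<inter> f j ` cell j = {}"
proof -
  have *: "f i ` cell i \<inter> f j ` cell j = {}" if "i < j" "j < k" for i j
  proof (cases "i + 1 = j")
    case True
    have "f i (exit_label i) \<notin> f i ` cell i \<inter> f j ` cell j"
      using inj[of i] exit_in[of i] True that by (auto simp: cell_def inj_on_def)
    moreover have "f i ` cell i \<inter> f j ` cell j \<subseteq> {f i (exit_label i)}"
      using meet[of i] True that cell_subset[of i] cell_subset[of j] unfolding exit_label_def by blast
    ultimately have "f i ` cell i \<inter> f j ` cell j \<subseteq> {}" by (rule subset_insert[THEN iffD1])
    then show ?thesis by (rule subset_empty[THEN iffD1])
  next
    case False
    then have "f i ` fst (bl i) \<inter> f j ` fst (bl j) = {}" using apart that by simp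
    then show ?thesis
      using Int_mono[OF image_mono[OF cell_subset] image_mono[OF cell_subset], of "f i" i "f j" j] by simp
  qed
  show ?thesis using *[of i j] *[of j i] assms by (cases "i < j") auto
qed

text \<open>The vertex removed from block \<open>i\<close> is the root of block
  \<open>i + 1\<close>, which stays in its cell because root and exit of a middle block differ. A
  cut vertex is thus counted in the later of its two blocks.\<close>

lemma cell_cover: "{..<n} = (\<Union>i<k. f i ` cell i)"
proof -
  have "f i p \<in> (\<Union>i<k. f i ` cell i)" if "i < k" "p \<in> fst (bl i)" for i p
  proof (cases "p \<in> cell i")
    case True
    then show ?thesis using that by blast
  next
    case False
    then have i: "i + 1 < k" and p: "p = exit_label i" using that by (auto simp: cell_def split: if_splits)
    have "block_root (bl (i + 1)) \<in> cell (i + 1)"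
      using root_in[OF i] i root_label[OF i] by (auto simp: cell_def exit_label_def)
    then show ?thesis using glue_root[OF i] i p by blast
  qed
  then have "(\<Union>i<k. f i ` fst (bl i)) \<subseteq> (\<Union>i<k. f i ` cell i)" by blast
  moreover have "(\<Union>i<k. f i ` cell i) \<subseteq> (\<Union>i<k. f i ` fst (bl i))"
    by (intro UN_mono image_mono cell_subset) simp
  ultimately show ?thesis unfolding lessThan_atLeast0 vertices by blast
qed

lemma sum_vertices: "(\<Sum>v<n. g v) = (\<Sum>i<k. \<Sum>p\<in>cell i. g (f i p))"
proof -
  have "(\<Sum>v<n. g v) = (\<Sum>i<k. sum g (f i ` cell i))"
    unfolding cell_cover using finite_cell cell_disjoint by (intro sum.UNION_disjoint) auto
  also have "\<dots> = (\<Sum>i<k. \<Sum>p\<in>cell i. g (f i p))"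
    by (rule sum.cong) (simp_all add: sum.reindex inj_on_subset[OF inj cell_subset])
  finally show ?thesis .
qed

lemma card_cell:
  assumes "i < k"
  shows "5 \<le> card (cell i)" "card (cell i) \<le> 10" "0 < i \<Longrightarrow> i < k - 1 \<Longrightarrow> card (cell i) = 5"
proof -
  note V = block_vertices[OF block_cases[OF assms]]
  have c: "card (cell i) = (if i + 1 < k then card (fst (bl i)) - 1 else card (fst (bl i)))"
    using exit_in V(1) by (simp add: cell_def)
  show "5 \<le> card (cell i)" "card (cell i) \<le> 10" using c V by (auto split: if_splits)
  show "card (cell i) = 5" if "0 < i" "i < k - 1"
    using c middle[OF that] that by (simp add: M0_def)
qed

lemma sum_split_ends:
  fixes g :: "nat \<Rightarrow> real"
  shows "(\<Sum>i<k. g i) = g 0 + (\<Sum>i=1..<k-1. g i) + g (k - 1)"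
proof -
  obtain m where m: "k = Suc (Suc m)" using k by (metis Suc_le_D numeral_2_eq_2 Suc_le_mono)
  have "(\<Sum>i<k. g i) = g 0 + (\<Sum>i<m. g (Suc i)) + g (Suc m)"
    unfolding m by (subst sum.lessThan_Suc, subst sum.lessThan_Suc_shift) simp
  also have "(\<Sum>i<m. g (Suc i)) = (\<Sum>i=1..<Suc m. g i)"
    unfolding lessThan_atLeast0 by (simp add: sum.shift_bounds_Suc_ivl[symmetric] del: sum.op_ivl_Suc)
  finally show ?thesis by (simp add: m)
qed

text \<open>An end cell has at most ten vertices, twice the five of a middle cell; counting the end
  values twice matches \<open>path_poincare_doubled_ends\<close>.\<close>

lemma weighted_cell_sum_le:
  fixes g :: "nat \<Rightarrow> real"
  assumes "\<And>i. 0 \<le> g i"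
  shows "(\<Sum>i<k. card (cell i) * g i) \<le> 5 * ((\<Sum>i<k. g i) + g 0 + g (k - 1))"
proof -
  have "(\<Sum>i=1..<k-1. card (cell i) * g i) = 5 * (\<Sum>i=1..<k-1. g i)"
    unfolding sum_distrib_left using card_cell(3) by (intro sum.cong) auto
  moreover have "card (cell i) * g i \<le> 10 * g i" if "i < k" for i
    using card_cell(2)[OF that] assms[of i] by (intro mult_right_mono) auto
  from this[of 0] this[of "k - 1"] have "card (cell 0) * g 0 \<le> 10 * g 0"
    "card (cell (k - 1)) * g (k - 1) \<le> 10 * g (k - 1)" using k by auto
  ultimately show ?thesis
    unfolding sum_split_ends[of "\<lambda>i. card (cell i) * g i"] sum_split_ends[of g] by simp
qed

lemma order_bounds: "5 * k \<le> n" "n \<le> 5 * k + 10"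
proof -
  have n: "real n = (\<Sum>i<k. real (card (cell i)) * 1)"
    using sum_vertices[of "\<lambda>_. 1 :: real"] by simp
  have "real (5 * k) = (\<Sum>i<k. 5 :: real)" by simp
  also have "\<dots> \<le> real n" unfolding n using card_cell(1) by (intro sum_mono) simp
  finally show "5 * k \<le> n" by linarith
  have "real n \<le> 5 * ((\<Sum>i<k. 1) + 1 + 1)" unfolding n by (rule weighted_cell_sum_le) simp
  then show "n \<le> 5 * k + 10" by simp
qed

text \<open>Different blocks share at most one vertex \<open>z\<close>, so a common edge would be
  the loop at \<open>z\<close>; hence the edge sets are disjoint.\<close>

lemma dirichlet_blocks: "dirichlet E x = (\<Sum>i<k. dirichlet (snd (bl i)) (x \<circ> f i))"
proof -
  note be = block_edges[OF block_cases]
  have img: "img_edges (f i) (bl i) \<subseteq> f i ` fst (bl i) \<times> f i ` fst (bl i)"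
    "\<And>p. (p, p) \<notin> img_edges (f i) (bl i)" if "i < k" for i
  proof -
    show "img_edges (f i) (bl i) \<subseteq> f i ` fst (bl i) \<times> f i ` fst (bl i)"
      using be(2)[OF that] unfolding img_edges_def by auto
    then show "(p, p) \<notin> img_edges (f i) (bl i)" for p
      using graph edges that unfolding simple_graph_def by blast
  qed
  have *: "img_edges (f i) (bl i) \<inter> img_edges (f j) (bl j) = {}" if ij: "i < j" "j < k" for i j
  proof -
    have "\<exists>z. f i ` fst (bl i) \<inter> f j ` fst (bl j) \<subseteq> {z}"
      using meet[of i] apart[of i j] ij by (cases "i + 1 = j") auto
    then obtain z where z: "f i ` fst (bl i) \<inter> f j ` fst (bl j) \<subseteq> {z}" by blast
    have "img_edges (f i) (bl i) \<inter> img_edges (f j) (bl j)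
        \<subseteq> (f i ` fst (bl i) \<inter> f j ` fst (bl j)) \<times> (f i ` fst (bl i) \<inter> f j ` fst (bl j))"
      unfolding Times_Int_Times[symmetric] using ij by (intro Int_mono img(1)) auto
    also have "\<dots> \<subseteq> {(z, z)}" using z by blast
    finally show ?thesis using img(2)[of i z] ij by auto
  qed
  have "dirichlet E x = (\<Sum>i<k. dirichlet (img_edges (f i) (bl i)) x)"
    unfolding dirichlet_def edges
  proof (rule sum.UNION_disjoint)
    show "\<forall>i\<in>{..<k}. finite (img_edges (f i) (bl i))"
      using be(1) by (auto simp: img_edges_def)
    show "\<forall>i\<in>{..<k}. \<forall>j\<in>{..<k}. i \<noteq> j \<longrightarrow> img_edges (f i) (bl i) \<inter> img_edges (f j) (bl j) = {}"
    proof (intro ballI impI)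
      fix i j assume "i \<in> {..<k}" "j \<in> {..<k}" "i \<noteq> j"
      then show "img_edges (f i) (bl i) \<inter> img_edges (f j) (bl j) = {}"
        using *[of i j] *[of j i] by (cases "i < j") auto
    qed
  qed simp
  also have "\<dots> = (\<Sum>i<k. dirichlet (snd (bl i)) (x \<circ> f i))"
    using inj be(2) by (intro sum.cong refl dirichlet_img_edges) auto
  finally show ?thesis .
qed

text \<open>Up to an error bounded by the local energy, a function is constant on the cells, and its
  energy dominates that of its restriction to the path of cut vertices.\<close>

lemma variance_le_dirichlet:
  fixes x :: "nat \<Rightarrow> real"
  assumes mean: "(\<Sum>v<n. x v) = 0"
  shows "(\<Sum>v<n. (x v)\<^sup>2) \<le> ((1 + 1 / k) * (25 / 8) / (2 - 2 * cos (pi / (real k + 2)))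
    + 810 * (1 + real k)) * dirichlet E x"
proof -
  define lam where "lam = 2 - 2 * cos (pi / (real k + 2))"
  have lam: "lam > 0"
    using path_eigenvalue_pos[of "k + 2"] by (simp add: lam_def add.commute)
  define y where "y i = x (f i (block_root (bl i)))" for i
  define D where "D i = dirichlet (snd (bl i)) (x \<circ> f i)" for i
  define G where "G = dirichlet E x"
  have D: "(\<Sum>i<k. D i) = G" unfolding D_def G_def dirichlet_blocks ..
  have D0: "0 \<le> D i" for i unfolding D_def by (rule dirichlet_nonneg)
  \<comment> \<open>\<open>5 / 8\<close> is the reciprocal of the constant in
    \<open>M0_dirichlet_ge\<close>. The first increment is zero, as \<open>y 0\<close> and
    \<open>y 1\<close> are values at the same cut vertex.\<close>
  have diff: "(y (Suc i) - y i)\<^sup>2 \<le> 5 / 8 * D i" if "i < k - 1" for i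
  proof (cases "i = 0")
    case True
    then have "y (Suc i) = y i"
      using glue_root[of 0] that k by (simp add: y_def root_label exit_label_def)
    then show ?thesis using D0 by simp
  next
    case False
    then have M0: "bl i = M0" using middle that by simp
    have "y (Suc i) = x (f i vv)"
      using glue_root[of i] that False by (simp add: y_def exit_label_def)
    moreover have "y i = x (f i vu)" using that False by (simp add: y_def root_label)
    ultimately show ?thesis
      using M0_dirichlet_ge[of "x \<circ> f i"] by (simp add: D_def M0)
  qed
  \<comment> \<open>The path has one vertex per block; doubling both ends gives the
    \<open>(k - 1) + 3 = k + 2\<close> in \<open>lam\<close>.\<close>
  obtain c where c: "lam * ((\<Sum>j<Suc (k - 1). (y j - c)\<^sup>2) + (y 0 - c)\<^sup>2 + (y (k - 1) - c)\<^sup>2)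
      \<le> (\<Sum>j<k - 1. (y (Suc j) - y j)\<^sup>2)"
    using path_poincare_doubled_ends[of "k - 1" y] k unfolding lam_def
    by (auto simp: of_nat_diff algebra_simps)
  define S where "S = (\<Sum>j<k. (y j - c)\<^sup>2) + (y 0 - c)\<^sup>2 + (y (k - 1) - c)\<^sup>2"
  have "lam * S \<le> (\<Sum>j<k - 1. (y (Suc j) - y j)\<^sup>2)" using c k by (simp add: S_def)
  also have "\<dots> \<le> (\<Sum>j<k - 1. 5 / 8 * D j)" using diff by (intro sum_mono) auto
  also have "\<dots> \<le> (\<Sum>j<k. 5 / 8 * D j)" using D0 by (intro sum_mono2) auto
  also have "\<dots> = 5 / 8 * G" unfolding D[symmetric] sum_distrib_left ..
  finally have S: "S \<le> 5 / 8 * G / lam" using lam by (simp add: field_simps)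
  \<comment> \<open>The centre \<open>c\<close> comes from the path and need not be the mean of
    \<open>x\<close>, but a mean-zero function has its least square sum about 0.\<close>
  have "(\<Sum>v<n. (x v)\<^sup>2) \<le> (\<Sum>v<n. (x v)\<^sup>2) - 2 * c * (\<Sum>v<n. x v) + n * c\<^sup>2"
    using mean by simp
  also have "\<dots> = (\<Sum>v<n. (x v - c)\<^sup>2)"
    by (simp add: power2_diff sum.distrib sum_subtractf sum_distrib_left mult_ac)
  also have "\<dots> = (\<Sum>i<k. \<Sum>p\<in>cell i. (x (f i p) - c)\<^sup>2)" by (rule sum_vertices)
  \<comment> \<open>\<open>810\<close> is 10 times 81: at most ten vertices in a cell, each with the
    error allowed by \<open>block_oscillation\<close>.\<close>
  also have "\<dots> \<le> (\<Sum>i<k. (1 + 1 / k) * (card (cell i) * (y i - c)\<^sup>2) + (1 + k) * (810 * D i))"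
  proof (rule sum_mono)
    fix i assume "i \<in> {..<k}"
    then have i: "i < k" by simp
    have "(\<Sum>p\<in>cell i. (x (f i p) - c)\<^sup>2) \<le> (\<Sum>p\<in>cell i. (1 + 1 / k) * (y i - c)\<^sup>2 + (1 + k) * (81 * D i))"
    proof (rule sum_mono)
      fix p assume p: "p \<in> cell i"
      have "(x (f i p) - c)\<^sup>2 = ((y i - c) + (x (f i p) - y i))\<^sup>2" by simp
      also have "\<dots> \<le> (1 + 1 / k) * (y i - c)\<^sup>2 + (1 + 1 / (1 / k)) * (x (f i p) - y i)\<^sup>2"
        by (rule weighted_square_sum_le) (use k in simp)
      also have "(x (f i p) - y i)\<^sup>2 \<le> 81 * D i"
        using block_oscillation[OF block_cases[OF i], of p "x \<circ> f i"] p cell_subset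
        by (auto simp: D_def y_def)
      finally show "(x (f i p) - c)\<^sup>2 \<le> (1 + 1 / k) * (y i - c)\<^sup>2 + (1 + k) * (81 * D i)"
        by (simp add: mult_left_mono)
    qed
    also have "\<dots> = (1 + 1 / k) * (card (cell i) * (y i - c)\<^sup>2) + card (cell i) * ((1 + k) * (81 * D i))"
      by (simp add: algebra_simps)
    also have "card (cell i) * ((1 + k) * (81 * D i)) \<le> 10 * ((1 + k) * (81 * D i))"
      using card_cell(2)[OF i] D0[of i] by (intro mult_right_mono) auto
    finally show "(\<Sum>p\<in>cell i. (x (f i p) - c)\<^sup>2)
        \<le> (1 + 1 / k) * (card (cell i) * (y i - c)\<^sup>2) + (1 + k) * (810 * D i)" by simp
  qed
  also have "\<dots> = (1 + 1 / k) * (\<Sum>i<k. card (cell i) * (y i - c)\<^sup>2) + (1 + k) * (810 * G)"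
    unfolding D[symmetric] by (simp add: sum.distrib sum_distrib_left)
  also have "\<dots> \<le> (1 + 1 / k) * (25 / 8 * G / lam) + (1 + k) * (810 * G)"
  proof (intro add_right_mono mult_left_mono)
    have "(\<Sum>i<k. card (cell i) * (y i - c)\<^sup>2) \<le> 5 * S"
      unfolding S_def by (rule weighted_cell_sum_le) simp
    also have "\<dots> \<le> 25 / 8 * G / lam" using S by simp
    finally show "(\<Sum>i<k. card (cell i) * (y i - c)\<^sup>2) \<le> 25 / 8 * G / lam" .
  qed simp
  finally show ?thesis unfolding G_def[symmetric] lam_def[symmetric]
    by (simp add: algebra_simps)
qed

end

section \<open>The cosine test function and the upper bound\<close>

text \<open>Multiplying by \<open>2 * sin (b / 2)\<close> turns each cosine into a difference of
  sines at half-integer steps, and the sum telescopes.\<close>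

lemma sum_cos_arithmetic:
  "2 * sin (b / 2) * (\<Sum>i<m. cos (a + real i * b)) = sin (a + (real m - 1 / 2) * b) - sin (a - b / 2)"
proof (induct m)
  case (Suc m)
  have "a + (real m + 1 / 2) * b = (a + real m * b) + b / 2" "a + (real m - 1 / 2) * b = (a + real m * b) - b / 2"
    by (simp_all add: algebra_simps)
  then have "2 * sin (b / 2) * cos (a + real m * b) = sin (a + (real m + 1 / 2) * b) - sin (a + (real m - 1 / 2) * b)"
    by (simp only: sin_add sin_diff) simp
  with Suc show ?case by (simp add: algebra_simps)
qed (simp add: algebra_simps)

context
  fixes K :: nat
  assumes K: "2 \<le> K"
begin

lemma sin_pi_over_pos: "sin (pi / real K) > 0" "sin (pi / (2 * real K)) > 0"
  by (rule sin_gt_zero; use K in \<open>simp add: field_simps\<close>)+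

text \<open>These half-integer nodes sample the first nonconstant eigenvector of the path with
  \<open>K\<close> vertices.\<close>

lemma sum_path_cos: "(\<Sum>i<K. cos (pi * (real (Suc i) - 1 / 2) / K)) = 0"
proof -
  have "cos (pi * (real (Suc i) - 1 / 2) / K) = cos (pi / (2 * K) + real i * (pi / K))" for i
    using K by (intro arg_cong[of _ _ cos]) (simp add: field_simps)
  moreover have "pi / (2 * K) + (real K - 1 / 2) * (pi / K) = pi" "pi / (2 * K) - pi / K / 2 = 0"
    using K by (simp_all add: field_simps)
  ultimately show ?thesis
    using sum_cos_arithmetic[of "pi / K" "pi / (2 * K)" K] sin_pi_over_pos(2)
    by (simp add: mult.commute)
qed

lemma sum_path_cos_squared: "(\<Sum>i<K. (cos (pi * (real (Suc i) - 1 / 2) / K))\<^sup>2) = K / 2"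
proof -
  have *: "(cos (pi * (real (Suc i) - 1 / 2) / K))\<^sup>2 = 1 / 2 + cos (pi / K + real i * (2 * pi / K)) / 2" for i
  proof -
    have "pi / K + real i * (2 * pi / K) = 2 * (pi * (real (Suc i) - 1 / 2) / K)"
      using K by (simp add: field_simps)
    then show ?thesis by (simp only: cos_double_cos) (simp add: field_simps)
  qed
  have "pi / K + (real K - 1 / 2) * (2 * pi / K) = 2 * pi" "pi / K - 2 * pi / K / 2 = 0" "2 * pi / K / 2 = pi / K"
    using K by (simp_all add: field_simps)
  then have "(\<Sum>i<K. cos (pi / K + real i * (2 * pi / K))) = 0"
    using sum_cos_arithmetic[of "2 * pi / K" "pi / K" K] sin_pi_over_pos(1) by simp
  then show ?thesis unfolding * sum.distrib by (simp flip: sum_divide_distrib)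
qed

lemma sum_sin_squared: "(\<Sum>i<Suc K. (sin (pi * real i / K))\<^sup>2) = K / 2"
proof -
  have *: "(sin (pi * real i / K))\<^sup>2 = 1 / 2 - cos (0 + real i * (2 * pi / K)) / 2" for i
  proof -
    have "0 + real i * (2 * pi / K) = 2 * (pi * real i / K)" by simp
    then show ?thesis by (simp only: cos_double_sin) (simp add: field_simps)
  qed
  have "0 + (real K - 1 / 2) * (2 * pi / K) = 2 * pi - pi / K" "0 - 2 * pi / K / 2 = - (pi / K)" "2 * pi / K / 2 = pi / K"
    using K by (simp_all add: field_simps)
  then have "(\<Sum>i<K. cos (0 + real i * (2 * pi / K))) = 0"
    using sum_cos_arithmetic[of "2 * pi / K" 0 K] sin_pi_over_pos(1) by (simp add: sin_diff)
  then have "(\<Sum>i<K. (sin (pi * real i / K))\<^sup>2) = K / 2"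
    unfolding * sum_subtractf by (simp flip: sum_divide_distrib)
  then show ?thesis using K by simp
qed

text \<open>Up to sign an increment is \<open>2 * sin (pi / (2 * K)) * sin (pi * i / K)\<close>. The
  outermost ones, \<open>i = 0\<close> and \<open>i = K\<close>, vanish: this is the reflection at
  the ends that lets the test function be constant on the end blocks.\<close>

lemma sum_path_cos_increments:
  "(\<Sum>i<Suc K. (cos (pi * (real (Suc i) - 1 / 2) / K) - cos (pi * (real i - 1 / 2) / K))\<^sup>2)
    \<le> pi\<^sup>2 / (2 * K)"
proof -
  have *: "(cos (pi * (real (Suc i) - 1 / 2) / K) - cos (pi * (real i - 1 / 2) / K))\<^sup>2
      \<le> (pi / K)\<^sup>2 * (sin (pi * real i / K))\<^sup>2" for i
  proof -
    have "(pi * (real (Suc i) - 1 / 2) / K + pi * (real i - 1 / 2) / K) / 2 = pi * real i / K"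
      "(pi * (real i - 1 / 2) / K - pi * (real (Suc i) - 1 / 2) / K) / 2 = - (pi / (2 * K))"
      using K by (simp_all add: field_simps)
    then have "cos (pi * (real (Suc i) - 1 / 2) / K) - cos (pi * (real i - 1 / 2) / K)
        = 2 * sin (pi * real i / K) * sin (- (pi / (2 * K)))"
      by (simp only: cos_diff_cos)
    then have "(cos (pi * (real (Suc i) - 1 / 2) / K) - cos (pi * (real i - 1 / 2) / K))\<^sup>2
        = (2 * sin (pi / (2 * K)))\<^sup>2 * (sin (pi * real i / K))\<^sup>2"
      by (simp add: power_mult_distrib)
    also have "(2 * sin (pi / (2 * K)))\<^sup>2 \<le> (pi / K)\<^sup>2"
      using sin_x_le_x[of "pi / (2 * K)"] sin_pi_over_pos(2) by (intro power_mono) (auto simp: field_simps)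
    finally show ?thesis by (simp add: mult_right_mono)
  qed
  have "(\<Sum>i<Suc K. (cos (pi * (real (Suc i) - 1 / 2) / K) - cos (pi * (real i - 1 / 2) / K))\<^sup>2)
      \<le> (\<Sum>i<Suc K. (pi / K)\<^sup>2 * (sin (pi * real i / K))\<^sup>2)"
    by (intro sum_mono *)
  also have "\<dots> = (pi / K)\<^sup>2 * (K / 2)"
    unfolding sum_distrib_left[symmetric] sum_sin_squared ..
  also have "\<dots> = pi\<^sup>2 / (2 * K)" using K by (simp add: power2_eq_square field_simps)
  finally show ?thesis .
qed

end

text \<open>Equilibrium potential of the unit voltage between \<open>u\<close> and \<open>v\<close> in \<open>M\<^sub>0\<close>.\<close>

definition potential :: "nat \<Rightarrow> real" where
  "potential p = (if p = vu then 0 else if p \<le> 1 then 2 / 5 else if p \<le> 3 then 3 / 5 else 1)"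

lemma potential_bounds: "0 \<le> potential p" "potential p \<le> 1"
  by (auto simp: potential_def)

text \<open>The equality case of \<open>M0_dirichlet_ge\<close>; it makes the leading constants of
  the upper and lower bounds agree.\<close>

lemma M0_dirichlet_potential: "dirichlet (snd M0) (\<lambda>p. a + potential p * d) = 8 / 5 * d\<^sup>2"
  unfolding M0_dirichlet by (simp add: potential_def power2_eq_square field_simps)

section \<open>The test function on a chain of blocks\<close>

context block_chain
begin

text \<open>A vertex has a unique address (block, label) among the cells, and \<open>x\<close> reads
  off \<open>T\<close> there. At an exit, which lies outside its own cell, \<open>compat\<close>
  transfers the value from the root of the next block.\<close>

lemma glue_functions:
  fixes T :: "nat \<Rightarrow> nat \<Rightarrow> real"
  assumes compat: "\<And>i. i + 1 < k \<Longrightarrow> T i (exit_label i) = T (i + 1) (block_root (bl (i + 1)))"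
  shows "\<exists>x. \<forall>i<k. \<forall>p\<in>fst (bl i). x (f i p) = T i p"
proof -
  define S where "S = (SIGMA i:{..<k}. cell i)"
  define F where "F = (\<lambda>(i, p). f i p)"
  have "inj_on F S"
  proof (rule inj_onI)
    fix a b assume a: "a \<in> S" and b: "b \<in> S" and eq: "F a = F b"
    obtain i p j q where ij: "a = (i, p)" "b = (j, q)" by (cases a, cases b)
    have "i = j" using cell_disjoint[of i j] a b eq by (force simp: S_def F_def ij)
    then show "a = b"
      using inj_onD[OF inj, of i p q] a b eq cell_subset by (auto simp: S_def F_def ij)
  qed
  define x where "x v = (case inv_into S F v of (i, p) \<Rightarrow> T i p)" for v
  have cell: "x (f i p) = T i p" if "i < k" "p \<in> cell i" for i p
    using inv_into_f_f[OF \<open>inj_on F S\<close>, of "(i, p)"] that by (simp add: x_def S_def F_def)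
  have "x (f i p) = T i p" if i: "i < k" and p: "p \<in> fst (bl i)" for i p
  proof (cases "p \<in> cell i")
    case False
    then have i': "i + 1 < k" and p': "p = exit_label i" using p by (auto simp: cell_def split: if_splits)
    have "block_root (bl (i + 1)) \<in> cell (i + 1)"
      using root_in[OF i'] i' root_label[OF i'] by (auto simp: cell_def exit_label_def)
    from cell[OF i' this] show ?thesis using glue_root[OF i'] compat[OF i'] p' by simp
  qed (use cell i in simp)
  then show ?thesis by blast
qed

text \<open>The square sum is bounded about every \<open>m\<close>, so the mean of the test function
  never has to be computed.\<close>

lemma cosine_test_function:
  assumes k3: "3 \<le> k"
  shows "\<exists>x. dirichlet E x \<le> 4 / 5 * pi\<^sup>2 / (real k - 1)
    \<and> (\<forall>m. 5 / 2 * (real k - 2 - pi\<^sup>2) \<le> (\<Sum>v<n. (x v - m)\<^sup>2))"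
proof -
  define K where "K = k - 1"
  have K: "2 \<le> K" and kK: "k = Suc K" using k3 by (auto simp: K_def)
  \<comment> \<open>\<open>y 1\<close>, ..., \<open>y K\<close> are the values at the
    \<open>k - 1\<close> cut vertices; \<open>y 0\<close> and \<open>y (Suc K)\<close> are their
    reflections at the two ends.\<close>
  define y where "y i = cos (pi * (real i - 1 / 2) / K)" for i :: nat
  have y0: "y (Suc 0) = y 0"
    using cos_minus[of "pi * (1 / 2) / K"] by (simp add: y_def)
  have yK: "y (Suc K) = y K"
  proof -
    have "pi * (real (Suc K) - 1 / 2) / K = pi + pi / (2 * K)" "pi * (real K - 1 / 2) / K = pi - pi / (2 * K)"
      using K by (simp_all add: field_simps)
    then show ?thesis unfolding y_def by (simp only: cos_add cos_diff) simp
  qed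
  \<comment> \<open>On an end block \<open>y (Suc i) = y i\<close>, so \<open>T\<close> is constant
    there and the block carries no energy.\<close>
  define T where "T i p = y i + potential p * (y (Suc i) - y i)" for i p
  have "T i (exit_label i) = T (i + 1) (block_root (bl (i + 1)))" if i: "i + 1 < k" for i
  proof -
    have "T i (exit_label i) = y (Suc i)" by (simp add: T_def potential_def exit_label_def)
    moreover have "T (i + 1) (block_root (bl (i + 1))) = y (Suc i)"
      using root_label[OF i] yK kK i by (auto simp: T_def potential_def)
    ultimately show ?thesis by simp
  qed
  from glue_functions[OF this] obtain x where x: "\<And>i p. i < k \<Longrightarrow> p \<in> fst (bl i) \<Longrightarrow> x (f i p) = T i p"
    by blast
  have tail: "(\<Sum>i<K. g (Suc i)) \<le> (\<Sum>i<k. g i)" if "0 \<le> g 0" for g :: "nat \<Rightarrow> real"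
    unfolding kK sum.lessThan_Suc_shift using that by simp
  have incr: "(\<Sum>i<k. (y (Suc i) - y i)\<^sup>2) \<le> pi\<^sup>2 / (2 * K)"
    unfolding y_def kK by (rule sum_path_cos_increments[OF K])
  have "dirichlet (snd (bl i)) (x \<circ> f i) = 8 / 5 * (y (Suc i) - y i)\<^sup>2" if i: "i < k" for i
  proof -
    have "dirichlet (snd (bl i)) (x \<circ> f i) = dirichlet (snd (bl i)) (T i)"
      unfolding dirichlet_def using x[OF i] block_edges(2)[OF block_cases[OF i]]
      by (intro sum.cong) auto
    also have "\<dots> = 8 / 5 * (y (Suc i) - y i)\<^sup>2"
    proof (cases "0 < i \<and> i < k - 1")
      case True
      then have "bl i = M0" using middle by blast
      then show ?thesis using M0_dirichlet_potential unfolding T_def by simp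
    next
      case False
      then have "i = 0 \<or> i = K" using i kK by auto
      then have "y (Suc i) = y i" using y0 yK by auto
      then show ?thesis by (simp add: T_def dirichlet_def)
    qed
    finally show ?thesis .
  qed
  then have "dirichlet E x = 8 / 5 * (\<Sum>i<k. (y (Suc i) - y i)\<^sup>2)"
    unfolding dirichlet_blocks sum_distrib_left by (intro sum.cong) auto
  with incr have energy: "dirichlet E x \<le> 4 / 5 * pi\<^sup>2 / (real k - 1)"
    by (simp add: kK)
  have "5 / 2 * (real k - 2 - pi\<^sup>2) \<le> (\<Sum>v<n. (x v - m)\<^sup>2)" for m
  proof -
    have sumy: "(\<Sum>i<K. y (Suc i)) = 0" "(\<Sum>i<K. (y (Suc i))\<^sup>2) = K / 2"
      unfolding y_def using sum_path_cos[OF K] sum_path_cos_squared[OF K] by auto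
    \<comment> \<open>Lower bound for the contribution of any vertex of \<open>cell i\<close>, from
      \<open>weighted_square_sum_ge\<close> with weight \<open>1 / K\<close>. Summed over the path,
      the loss stays bounded while the main term grows like \<open>K\<close>.\<close>
    define q where "q i = (1 - 1 / K) * (y i - m)\<^sup>2 - K * (y (Suc i) - y i)\<^sup>2" for i
    have "(\<Sum>i<K. (y (Suc i) - m)\<^sup>2) = (\<Sum>i<K. (y (Suc i))\<^sup>2) - 2 * m * (\<Sum>i<K. y (Suc i)) + K * m\<^sup>2"
      by (simp add: power2_diff sum.distrib sum_subtractf sum_distrib_left mult_ac)
    then have var: "K / 2 \<le> (\<Sum>i<K. (y (Suc i) - m)\<^sup>2)" by (simp add: sumy)
    have "(\<Sum>i<K. (y (Suc (Suc i)) - y (Suc i))\<^sup>2) \<le> (\<Sum>i<k. (y (Suc i) - y i)\<^sup>2)"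
      by (rule tail) simp
    with incr have inc: "(\<Sum>i<K. (y (Suc (Suc i)) - y (Suc i))\<^sup>2) \<le> pi\<^sup>2 / (2 * K)" by simp
    have "5 / 2 * (real k - 2 - pi\<^sup>2) = 5 * ((1 - 1 / K) * (K / 2) - K * (pi\<^sup>2 / (2 * K)))"
      using K by (simp add: kK field_simps)
    also have "\<dots> \<le> 5 * ((1 - 1 / K) * (\<Sum>i<K. (y (Suc i) - m)\<^sup>2)
        - K * (\<Sum>i<K. (y (Suc (Suc i)) - y (Suc i))\<^sup>2))"
      using K var inc by (intro mult_left_mono diff_mono) auto
    also have "\<dots> = (\<Sum>i<K. 5 * q (Suc i))"
      by (simp add: q_def sum_subtractf sum_distrib_left algebra_simps)
    also have "\<dots> \<le> (\<Sum>i<K. \<Sum>p\<in>cell (Suc i). (x (f (Suc i) p) - m)\<^sup>2)"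
    proof (rule sum_mono)
      fix j assume "j \<in> {..<K}"
      then have i: "Suc j < k" by (simp add: kK)
      define i where "i = Suc j"
      have cellwise: "q i \<le> (x (f i p) - m)\<^sup>2" if p: "p \<in> cell i" for p
      proof -
        define d where "d = y (Suc i) - y i"
        have "(potential p * d)\<^sup>2 \<le> d\<^sup>2"
          using potential_bounds[of p] by (simp add: power_mult_distrib mult_left_le_one_le power_le_one)
        then have "q i \<le> (1 - 1 / K) * (y i - m)\<^sup>2 - (potential p * d)\<^sup>2 / (1 / K)"
          unfolding q_def d_def by (simp add: mult_left_mono mult.commute)
        also have "\<dots> \<le> ((y i - m) + potential p * d)\<^sup>2"
          by (rule weighted_square_sum_ge) (use K in simp)
        also have "(y i - m) + potential p * d = x (f i p) - m"
          using x[OF i[folded i_def] subsetD[OF cell_subset p]] by (simp add: T_def d_def)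
        finally show ?thesis .
      qed
      \<comment> \<open>Cells of end blocks may have more than five vertices, so replacing the count
        by five needs \<open>q i\<close> to be nonnegative; for negative \<open>q i\<close> the
        claim is trivial.\<close>
      have "5 * q i \<le> (\<Sum>p\<in>cell i. (x (f i p) - m)\<^sup>2)"
      proof (cases "0 \<le> q i")
        case True
        have "5 * q i \<le> card (cell i) * q i"
          using card_cell(1)[of i] i True by (intro mult_right_mono) (auto simp: i_def)
        also have "\<dots> \<le> (\<Sum>p\<in>cell i. (x (f i p) - m)\<^sup>2)"
          using sum_mono[of "cell i" "\<lambda>_. q i"] cellwise by simp
        finally show ?thesis .
      next
        case False
        then show ?thesis using sum_nonneg[of "cell i" "\<lambda>p. (x (f i p) - m)\<^sup>2"] by simp
      qed
      then show "5 * q (Suc j) \<le> (\<Sum>p\<in>cell (Suc j). (x (f (Suc j) p) - m)\<^sup>2)"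
        unfolding i_def .
    qed
    also have "\<dots> \<le> (\<Sum>i<k. \<Sum>p\<in>cell i. (x (f i p) - m)\<^sup>2)"
      by (rule tail) (simp add: sum_nonneg)
    also have "\<dots> = (\<Sum>v<n. (x v - m)\<^sup>2)" by (rule sum_vertices[symmetric])
    finally show ?thesis .
  qed
  with energy show ?thesis by blast
qed

lemma alg_conn_upper:
  assumes "19 \<le> k"
  shows "alg_conn n E \<le> 4 / 25 * pi\<^sup>2 / ((real k - 1) * (real k - 2 - pi\<^sup>2))"
proof -
  have pi2: "pi\<^sup>2 < 4\<^sup>2" by (intro power_strict_mono pi_less_4) auto
  obtain x where D: "dirichlet E x \<le> 4 / 5 * pi\<^sup>2 / (real k - 1)"
    and V: "\<And>m. 5 / 2 * (real k - 2 - pi\<^sup>2) \<le> (\<Sum>v<n. (x v - m)\<^sup>2)"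
    using cosine_test_function assms by auto
  \<comment> \<open>The bound 19 exceeds 2 + 4^2, which suffices because pi is less than 4.\<close>
  have pos: "real k - 2 - pi\<^sup>2 > 0" using assms pi2 by simp
  define c where "c = 4 / 25 * pi\<^sup>2 / ((real k - 1) * (real k - 2 - pi\<^sup>2))"
  have c0: "0 \<le> c" using assms pos by (simp add: c_def)
  have "dirichlet E x / 2 \<le> c * (5 / 2 * (real k - 2 - pi\<^sup>2))"
  proof -
    have *: "4 / 25 * pi\<^sup>2 / (A * B) * (5 / 2 * B) = 4 / 5 * pi\<^sup>2 / A / 2"
      if "A \<noteq> 0" "B \<noteq> 0" for A B :: real
      using that by simp
    have "c * (5 / 2 * (real k - 2 - pi\<^sup>2)) = 4 / 5 * pi\<^sup>2 / (real k - 1) / 2"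
      unfolding c_def by (rule *) (use assms pos in auto)
    moreover have "dirichlet E x / 2 \<le> 4 / 5 * pi\<^sup>2 / (real k - 1) / 2"
      using D by (rule divide_right_mono) simp
    ultimately show ?thesis by (simp only:)
  qed
  also have "\<dots> \<le> c * (\<Sum>i<n. (x i - (\<Sum>j<n. x j) / n)\<^sup>2)"
    using V c0 by (rule mult_left_mono)
  finally show ?thesis
    unfolding c_def[symmetric] using V[of "(\<Sum>j<n. x j) / n"] pos c0 order_bounds(1) assms
    by (intro alg_conn_le[OF graph, of c x]) auto
qed

text \<open>Inverts the constant of \<open>variance_le_dirichlet\<close>; the factor 2 undoes the
  double count of edges in \<open>dirichlet\<close>.\<close>

lemma alg_conn_lower:
  "1 / (2 * ((1 + 1 / k) * (25 / 8) / (2 - 2 * cos (pi / (real k + 2))) + 810 * (1 + real k))) \<le> alg_conn n E"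
proof (rule alg_conn_ge[OF graph])
  show "2 \<le> n" using order_bounds(1) k by linarith
  fix x :: "nat \<Rightarrow> real" assume mean: "(\<Sum>v<n. x v) = 0"
  define B where "B = (1 + 1 / k) * (25 / 8) / (2 - 2 * cos (pi / (real k + 2))) + 810 * (1 + real k)"
  have "2 - 2 * cos (pi / (real k + 2)) > 0"
    using path_eigenvalue_pos[of "k + 2"] by (simp add: add.commute)
  then have "0 < B" unfolding B_def by (intro add_nonneg_pos divide_nonneg_pos) auto
  with variance_le_dirichlet[OF mean, folded B_def]
  show "1 / (2 * B) * (\<Sum>v<n. (x v)\<^sup>2) \<le> dirichlet E x / 2" by (simp add: field_simps)
qed

end

section \<open>From bounds in the number of blocks to the asymptotics in the order\<close>

lemma path_like_block_chain:
  assumes "simple_graph n E" "path_like_M0_D n E"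
  shows "\<exists>k bl f. block_chain n E k bl f"
  using assms unfolding path_like_M0_D_def
proof (elim exE conjE, goal_cases)
  case (1 k bl f)
  have "block_chain n E k bl f"
    by (rule block_chain.intro[OF 1(1-4) 1(5)[rule_format] 1(6)[rule_format] 1(7,8)
          1(9)[rule_format, THEN conjunct1] 1(9)[rule_format, THEN conjunct2] 1(10)[rule_format]])
      simp_all
  then show ?case by (intro exI)
qed

text \<open>The lower bound is paired with the smallest order \<open>5 k\<close> and the upper bound
  with the largest, \<open>5 k + 10\<close>, as allowed by \<open>order_bounds\<close>. The summand
  with 810 is linear in \<open>k\<close>, whereas the term with the cosine grows
  quadratically.\<close>

lemma lower_ratio_limit:
  "(\<lambda>k. 1 / (2 * ((1 + 1 / real k) * (25 / 8) / (2 - 2 * cos (pi / (real k + 2))) + 810 * (1 + real k)))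
      * (5 * real k)\<^sup>2 / (4 * pi\<^sup>2)) \<longlonglongrightarrow> 1"
  by real_asymp (simp add: power2_eq_square)

lemma upper_ratio_limit:
  "(\<lambda>k. 4 / 25 * pi\<^sup>2 / ((real k - 1) * (real k - 2 - pi\<^sup>2)) * (5 * real k + 10)\<^sup>2 / (4 * pi\<^sup>2))
    \<longlonglongrightarrow> 1"
  by real_asymp

theorem theorem2:
  shows "\<forall>\<epsilon>>0. \<exists>N. \<forall>n E.
           n \<ge> N \<and> simple_graph n E \<and> connected_graph n E \<and> quartic n E \<and>
           path_like_M0_D n E \<longrightarrow>
           \<bar>alg_conn n E / (4 * pi\<^sup>2 / (real n)\<^sup>2) - 1\<bar> < \<epsilon>"
proof (intro allI impI)
  fix \<epsilon> :: real assume "\<epsilon> > 0"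
  let ?l = "\<lambda>k :: nat. 1 / (2 * ((1 + 1 / real k) * (25 / 8) / (2 - 2 * cos (pi / (real k + 2))) + 810 * (1 + real k)))"
  let ?u = "\<lambda>k :: nat. 4 / 25 * pi\<^sup>2 / ((real k - 1) * (real k - 2 - pi\<^sup>2))"
  have "\<forall>\<^sub>F k in sequentially. ?l k * (5 * real k)\<^sup>2 / (4 * pi\<^sup>2) > 1 - \<epsilon>"
    using order_tendstoD(1)[OF lower_ratio_limit, of "1 - \<epsilon>"] \<open>\<epsilon> > 0\<close> by simp
  moreover have "\<forall>\<^sub>F k in sequentially. ?u k * (5 * real k + 10)\<^sup>2 / (4 * pi\<^sup>2) < 1 + \<epsilon>"
    using order_tendstoD(2)[OF upper_ratio_limit, of "1 + \<epsilon>"] \<open>\<epsilon> > 0\<close> by simp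
  ultimately have "\<forall>\<^sub>F k in sequentially. ?l k * (5 * real k)\<^sup>2 / (4 * pi\<^sup>2) > 1 - \<epsilon> \<and>
      ?u k * (5 * real k + 10)\<^sup>2 / (4 * pi\<^sup>2) < 1 + \<epsilon>"
    by (rule eventually_conj)
  then obtain k0 where k0: "\<And>k. k \<ge> k0 \<Longrightarrow> ?l k * (5 * real k)\<^sup>2 / (4 * pi\<^sup>2) > 1 - \<epsilon> \<and>
      ?u k * (5 * real k + 10)\<^sup>2 / (4 * pi\<^sup>2) < 1 + \<epsilon>"
    unfolding eventually_sequentially by blast
  \<comment> \<open>The threshold \<open>5 * (k0 + 19) + 10\<close> inverts the bound of the order
    by \<open>5 k + 10\<close>: it forces \<open>k\<close> to be at least both \<open>k0\<close> and
    19.\<close>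
  show "\<exists>N. \<forall>n E. n \<ge> N \<and> simple_graph n E \<and> connected_graph n E \<and> quartic n E \<and>
           path_like_M0_D n E \<longrightarrow>
           \<bar>alg_conn n E / (4 * pi\<^sup>2 / (real n)\<^sup>2) - 1\<bar> < \<epsilon>"
  proof (intro exI[of _ "5 * (k0 + 19) + 10"] allI impI)
    fix n E
    assume *: "5 * (k0 + 19) + 10 \<le> n \<and> simple_graph n E \<and> connected_graph n E \<and> quartic n E \<and>
           path_like_M0_D n E"
    then obtain k bl f where "block_chain n E k bl f" using path_like_block_chain by blast
    then interpret block_chain n E k bl f .
    define a where "a = alg_conn n E"
    have k: "k \<ge> k0" "k \<ge> 19" using * order_bounds(2) by auto
    have nl: "5 * real k \<le> real n" and nu: "real n \<le> 5 * real k + 10"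
      using order_bounds by auto
    have l: "?l k \<le> a" unfolding a_def by (rule alg_conn_lower)
    have u: "a \<le> ?u k" unfolding a_def by (rule alg_conn_upper[OF k(2)])
    have "2 - 2 * cos (pi / (real k + 2)) > 0"
      using path_eigenvalue_pos[of "k + 2"] by (simp add: add.commute)
    then have l0: "0 \<le> ?l k" by (intro divide_nonneg_nonneg mult_nonneg_nonneg add_nonneg_nonneg) auto
    have a0: "0 \<le> a" using l0 l by (rule order_trans)
    have "1 - \<epsilon> < ?l k * (5 * real k)\<^sup>2 / (4 * pi\<^sup>2)" using k0[OF k(1)] by blast
    also have "\<dots> \<le> a * (real n)\<^sup>2 / (4 * pi\<^sup>2)"
      using l a0 nl by (intro divide_right_mono mult_mono power_mono) auto
    finally have 1: "1 - \<epsilon> < a * (real n)\<^sup>2 / (4 * pi\<^sup>2)" .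
    have "a * (real n)\<^sup>2 / (4 * pi\<^sup>2) \<le> ?u k * (5 * real k + 10)\<^sup>2 / (4 * pi\<^sup>2)"
      using u a0 order_trans[OF a0 u] nu by (intro divide_right_mono mult_mono power_mono) auto
    also have "\<dots> < 1 + \<epsilon>" using k0[OF k(1)] by blast
    finally have 2: "a * (real n)\<^sup>2 / (4 * pi\<^sup>2) < 1 + \<epsilon>" .
    have "alg_conn n E / (4 * pi\<^sup>2 / (real n)\<^sup>2) = a * (real n)\<^sup>2 / (4 * pi\<^sup>2)"
      by (simp add: a_def)
    then show "\<bar>alg_conn n E / (4 * pi\<^sup>2 / (real n)\<^sup>2) - 1\<bar> < \<epsilon>"
      using 1 2 by linarith
  qed
qed

end
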